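(* Let $k$ be a field, let $S\subset\mathbb{P}^n$ be a finite set of distinct $k$-points, and let $\mathcal{L}(S)$ be the lattice of all subsets of $S$ of the form $S\cap L$ with $L$ a linear subspace of $\mathbb{P}^n$. Assume there exists a subset $\Lambda\subset\mathcal{L}(S)$ such that $|\Lambda|>1$ and such that the following property holds: for every $T\in\Lambda$ with $T\neq S$ there exists $T'\in\Lambda$ such that $T'\neq\emptyset$, $T'$ is linearly independent, $T\cap T'=\emptyset$, and $T\cup T'$ is an element of $\Lambda$. Then $S$ is Koszul. Moreover, a stronger property holds: the homogeneous coordinate ring $A_S$ of $S$ admits a Koszul filtration.
   Context: Fix a ground field $k$; points of $\mathbb{P}^n$ are $k$-points. Linear subspaces of $\mathbb{P}^n$ include the empty subspace and $\mathbb{P}^n$ itself (so $\emptyset$ and $S$ belong to $\mathcal{L}(S)$). A finite set of points of $\mathbb{P}^n$ is linearly independent if vectors in $k^{n+1}$ representing its points are linearly independent. For a finite set $S\subset\mathbb{P}^n$, its homogeneous coordinate ring is $A_S=k[x_0,\dots,x_n]/I_S$, where $I_S$ is the homogeneous ideal generated by the homogeneous polynomials vanishing on $S$ (with the convention $A_\emptyset=k$). A graded algebra is an associative $k$-algebra $A=\bigoplus_{m\ge 0}A_m$ with $A_0=k$; write $A_+=\bigoplus_{m\geq 1}A_m$. For a graded $A$-module $M$, $\operatorname{Tor}^A_{i,j}(k,M)$ denotes the component of internal degree $j$ of $\operatorname{Tor}^A_i(k,M)$. A graded algebra $A$ is Koszul if $\operatorname{Tor}^A_{i,j}(k,k)=0$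 whenever $i\ne j$. The set $S$ is called Koszul if $A_S$ is Koszul. A Koszul filtration of a commutative graded algebra $A$ is a family $\mathcal{F}$ of ideals of $A$ such that: every ideal in $\mathcal{F}$ is generated by elements of degree one; $0$ and $A_+$ belong to $\mathcal{F}$; and for every nonzero $I\in\mathcal{F}$ there is $J\in\mathcal{F}$ with $J\subset I$, $I/J$ cyclic, and $(J:I)\in\mathcal{F}$. *)

theory Defs
  imports
    "HOL-Algebra.QuotRing"
    "HOL-Algebra.Module"
    "HOL-Algebra.Algebraic_Closure_Type"
    "HOL-Analysis.Cartesian_Space"
    "HOL-Library.Poly_Mapping"
begin

unbundle no fps_syntax

section \<open>Graded algebras, graded modules and Tor\<close>

text \<open>
  A graded algebra is given by a HOL-Algebra ring \<open>A\<close> (not assumed commutative in this section)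
  and its homogeneous components \<open>G m \<subseteq> carrier A\<close>; the ground field is the component \<open>G 0\<close>, so that
  \<open>k\<close>-linearity is part of \<open>A\<close>-linearity. A graded left module is given by a module record \<open>M\<close> and
  its homogeneous components \<open>N j \<subseteq> carrier M\<close>; the multiplication and unit of \<open>M\<close> are never used.
\<close>

text \<open>The direct sum \<open>A_+\<close> of all components of positive degree.\<close>

definition irrelevant_ideal :: "('a, 'c) ring_scheme \<Rightarrow> (nat \<Rightarrow> 'a set) \<Rightarrow> 'a set" where
  "irrelevant_ideal A G =
     {finsum A f {1..d} | f d. \<forall>m\<in>{1..d}. f m \<in> G m}"

definition graded_hom ::
  "('a, 'c) ring_scheme \<Rightarrow> ('a, 'm, 'd) module_scheme \<Rightarrow> (nat \<Rightarrow> 'm set) \<Rightarrow>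
   ('a, 'n, 'e) module_scheme \<Rightarrow> (nat \<Rightarrow> 'n set) \<Rightarrow> ('m \<Rightarrow> 'n) set" where
  "graded_hom A M N M' N' =
     {f. f \<in> carrier M \<rightarrow> carrier M' \<and>
         (\<forall>u\<in>carrier M. \<forall>v\<in>carrier M. f (u \<oplus>\<^bsub>M\<^esub> v) = f u \<oplus>\<^bsub>M'\<^esub> f v) \<and>
         (\<forall>a\<in>carrier A. \<forall>u\<in>carrier M. f (a \<odot>\<^bsub>M\<^esub> u) = a \<odot>\<^bsub>M'\<^esub> f u) \<and>
         (\<forall>j. f ` N j \<subseteq> N' j)}"

text \<open>
  The free left module on a set \<open>B\<close>: the functions \<open>B \<rightarrow> A\<close> of finite support, extended by zero.
  If the basis element \<open>x\<close> has degree \<open>\<delta> x\<close>, then \<open>u\<close> is homogeneous of degree \<open>j\<close> iff each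
  coordinate \<open>u x\<close> is homogeneous of degree \<open>j - \<delta> x\<close>.
\<close>

definition free_module :: "('a, 'c) ring_scheme \<Rightarrow> 'b set \<Rightarrow> ('a, 'b \<Rightarrow> 'a) module" where
  "free_module A B =
     \<lparr>carrier = {u. (\<forall>x\<in>B. u x \<in> carrier A) \<and> (\<forall>x. x \<notin> B \<longrightarrow> u x = \<zero>\<^bsub>A\<^esub>) \<and>
                    finite {x. u x \<noteq> \<zero>\<^bsub>A\<^esub>}},
      monoid.mult = undefined, monoid.one = undefined,
      ring.zero = (\<lambda>_. \<zero>\<^bsub>A\<^esub>), ring.add = (\<lambda>u v x. u x \<oplus>\<^bsub>A\<^esub> v x),
      module.smult = (\<lambda>a u x. a \<otimes>\<^bsub>A\<^esub> u x)\<rparr>"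

definition free_grading ::
  "('a, 'c) ring_scheme \<Rightarrow> (nat \<Rightarrow> 'a set) \<Rightarrow> 'b set \<Rightarrow> ('b \<Rightarrow> nat) \<Rightarrow> nat \<Rightarrow> ('b \<Rightarrow> 'a) set" where
  "free_grading A G B \<delta> j =
     {u \<in> carrier (free_module A B).
        \<forall>x\<in>B. u x \<in> (if \<delta> x \<le> j then G (j - \<delta> x) else {\<zero>\<^bsub>A\<^esub>})}"

text \<open>
  An augmented complex \<open>\<dots> \<rightarrow> F\<^sub>1 \<rightarrow> F\<^sub>0 \<rightarrow> M\<close> of graded free modules: \<open>F\<^sub>i\<close> has basis \<open>gens i\<close>,
  with degrees \<open>gdeg i\<close>, and \<open>bd i\<close> is the map \<open>F\<^sub>i\<^sub>+\<^sub>1 \<rightarrow> F\<^sub>i\<close>.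
\<close>

record ('a, 'b, 'm) free_complex =
  gens :: "nat \<Rightarrow> 'b set"
  gdeg :: "nat \<Rightarrow> 'b \<Rightarrow> nat"
  bd   :: "nat \<Rightarrow> ('b \<Rightarrow> 'a) \<Rightarrow> ('b \<Rightarrow> 'a)"
  aug  :: "('b \<Rightarrow> 'a) \<Rightarrow> 'm"

abbreviation cplx_module ::
  "('a, 'c) ring_scheme \<Rightarrow> ('a, 'b, 'm) free_complex \<Rightarrow> nat \<Rightarrow> ('a, 'b \<Rightarrow> 'a) module" where
  "cplx_module A F i \<equiv> free_module A (gens F i)"

abbreviation cplx_grading ::
  "('a, 'c) ring_scheme \<Rightarrow> (nat \<Rightarrow> 'a set) \<Rightarrow> ('a, 'b, 'm) free_complex \<Rightarrow> nat \<Rightarrow> nat \<Rightarrow>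
   ('b \<Rightarrow> 'a) set" where
  "cplx_grading A G F i \<equiv> free_grading A G (gens F i) (gdeg F i)"

definition graded_free_resolution ::
  "('a, 'c) ring_scheme \<Rightarrow> (nat \<Rightarrow> 'a set) \<Rightarrow> ('a, 'm, 'd) module_scheme \<Rightarrow> (nat \<Rightarrow> 'm set) \<Rightarrow>
   ('a, 'b, 'm) free_complex \<Rightarrow> bool" where
  "graded_free_resolution A G M N F \<longleftrightarrow>
     (\<forall>i. bd F i \<in> graded_hom A (cplx_module A F (Suc i)) (cplx_grading A G F (Suc i))
                                (cplx_module A F i) (cplx_grading A G F i)) \<and>
     aug F \<in> graded_hom A (cplx_module A F 0) (cplx_grading A G F 0) M N \<and>
     aug F ` carrier (cplx_module A F 0) = carrier M \<and>
     {u \<in> carrier (cplx_module A F 0). aug F u = \<zero>\<^bsub>M\<^esub>} =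
       bd F 0 ` carrier (cplx_module A F (Suc 0)) \<and>
     (\<forall>i. {u \<in> carrier (cplx_module A F (Suc i)). bd F i u = \<zero>\<^bsub>cplx_module A F i\<^esub>} =
       bd F (Suc i) ` carrier (cplx_module A F (Suc (Suc i))))"

text \<open>
  A chosen graded free resolution of \<open>M\<close>. Basis elements are taken from \<open>nat \<times> 'a \<times> 'm\<close>, an
  infinite type at least as large as \<open>A\<close> and \<open>M\<close>. Every free module on a subset of that type again
  has at most as many elements as the type, so the successive kernels can be covered by free modules
  with bases in the same type: every graded module over every graded algebra has such a resolution.
\<close>

definition chosen_resolution ::
  "('a, 'c) ring_scheme \<Rightarrow> (nat \<Rightarrow> 'a set) \<Rightarrow> ('a, 'm, 'd) module_scheme \<Rightarrow> (nat \<Rightarrow> 'm set) \<Rightarrow>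
   ('a, nat \<times> 'a \<times> 'm, 'm) free_complex" where
  "chosen_resolution A G M N = (SOME F. graded_free_resolution A G M N F)"

text \<open>
  Homology of \<open>k \<otimes>\<^sub>A F\<close>. Since \<open>k = A/A_+\<close>, the module \<open>k \<otimes>\<^sub>A F\<^sub>i\<close> is \<open>F\<^sub>i / A_+ F\<^sub>i\<close>, and \<open>A_+ F\<^sub>i\<close> consists
  of the elements with all coordinates in \<open>A_+\<close>. Cycles and boundaries of internal degree \<open>j\<close> are
  given by their preimages in the degree \<open>j\<close> part of \<open>F\<^sub>i\<close>; both preimages contain \<open>(A_+ F\<^sub>i)\<^sub>j\<close>, so
  their quotient is the homology group.
\<close>

definition irrelevant_part ::
  "('a, 'c) ring_scheme \<Rightarrow> (nat \<Rightarrow> 'a set) \<Rightarrow> ('a, 'b, 'm) free_complex \<Rightarrow> nat \<Rightarrow> ('b \<Rightarrow> 'a) set" where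
  "irrelevant_part A G F i =
     {u \<in> carrier (cplx_module A F i). \<forall>x\<in>gens F i. u x \<in> irrelevant_ideal A G}"

definition tensor_cycles ::
  "('a, 'c) ring_scheme \<Rightarrow> (nat \<Rightarrow> 'a set) \<Rightarrow> ('a, 'b, 'm) free_complex \<Rightarrow> nat \<Rightarrow> nat \<Rightarrow>
   ('b \<Rightarrow> 'a) set" where
  "tensor_cycles A G F i j =
     {u \<in> cplx_grading A G F i j.
        (case i of 0 \<Rightarrow> True | Suc l \<Rightarrow> bd F l u \<in> irrelevant_part A G F l)}"

definition tensor_boundaries ::
  "('a, 'c) ring_scheme \<Rightarrow> (nat \<Rightarrow> 'a set) \<Rightarrow> ('a, 'b, 'm) free_complex \<Rightarrow> nat \<Rightarrow> nat \<Rightarrow>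
   ('b \<Rightarrow> 'a) set" where
  "tensor_boundaries A G F i j =
     bd F i ` cplx_grading A G F (Suc i) j
       <+>\<^bsub>cplx_module A F i\<^esub> (irrelevant_part A G F i \<inter> cplx_grading A G F i j)"

definition tensor_homology ::
  "('a, 'c) ring_scheme \<Rightarrow> (nat \<Rightarrow> 'a set) \<Rightarrow> ('a, 'b, 'm) free_complex \<Rightarrow> nat \<Rightarrow> nat \<Rightarrow>
   ('b \<Rightarrow> 'a) set monoid" where
  "tensor_homology A G F i j =
     (add_monoid (cplx_module A F i)) \<lparr>carrier := tensor_cycles A G F i j\<rparr>
       Mod tensor_boundaries A G F i j"

text \<open>\<open>Tor_group A G M N i j\<close> is the additive group of \<open>Tor\<^sup>A\<^sub>i\<^sub>,\<^sub>j(k, M)\<close>.\<close>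

definition Tor_group ::
  "('a, 'c) ring_scheme \<Rightarrow> (nat \<Rightarrow> 'a set) \<Rightarrow> ('a, 'm, 'd) module_scheme \<Rightarrow> (nat \<Rightarrow> 'm set) \<Rightarrow>
   nat \<Rightarrow> nat \<Rightarrow> (nat \<times> 'a \<times> 'm \<Rightarrow> 'a) set monoid" where
  "Tor_group A G M N i j = tensor_homology A G (chosen_resolution A G M N) i j"

text \<open>The ground field \<open>k = A/A_+\<close> as a graded \<open>A\<close>-module, concentrated in degree 0.\<close>

definition residue_module ::
  "('a, 'c) ring_scheme \<Rightarrow> (nat \<Rightarrow> 'a set) \<Rightarrow> ('a, 'a set) module" where
  "residue_module A G =
     (let Q = A Quot irrelevant_ideal A G in
      \<lparr>carrier = carrier Q, monoid.mult = monoid.mult Q, monoid.one = monoid.one Q,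
       ring.zero = ring.zero Q, ring.add = ring.add Q,
       module.smult = (\<lambda>a x. (irrelevant_ideal A G +>\<^bsub>A\<^esub> a) \<otimes>\<^bsub>Q\<^esub> x)\<rparr>)"

definition residue_grading ::
  "('a, 'c) ring_scheme \<Rightarrow> (nat \<Rightarrow> 'a set) \<Rightarrow> nat \<Rightarrow> 'a set set" where
  "residue_grading A G j =
     (if j = 0 then carrier (residue_module A G) else {\<zero>\<^bsub>residue_module A G\<^esub>})"

definition koszul_algebra :: "('a, 'c) ring_scheme \<Rightarrow> (nat \<Rightarrow> 'a set) \<Rightarrow> bool" where
  "koszul_algebra A G \<longleftrightarrow>
     (\<forall>i j. i \<noteq> j \<longrightarrow>
        carrier (Tor_group A G (residue_module A G) (residue_grading A G) i j) =
          {\<one>\<^bsub>Tor_group A G (residue_module A G) (residue_grading A G) i j\<^esub>})"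


section \<open>Koszul filtrations of commutative graded algebras\<close>

definition colon_ideal :: "('a, 'c) ring_scheme \<Rightarrow> 'a set \<Rightarrow> 'a set \<Rightarrow> 'a set" where
  "colon_ideal A J I = {a \<in> carrier A. \<forall>x\<in>I. a \<otimes>\<^bsub>A\<^esub> x \<in> J}"

text \<open>The condition \<open>I = J + (x)\<close> with \<open>x \<in> I\<close> says that \<open>I/J\<close> is cyclic.\<close>

definition koszul_filtration ::
  "('a, 'c) ring_scheme \<Rightarrow> (nat \<Rightarrow> 'a set) \<Rightarrow> 'a set set \<Rightarrow> bool" where
  "koszul_filtration A G \<F> \<longleftrightarrow>
     (\<forall>I\<in>\<F>. ideal I A \<and> (\<exists>E\<subseteq>G 1. I = Idl\<^bsub>A\<^esub> E)) \<and>
     {\<zero>\<^bsub>A\<^esub>} \<in> \<F> \<and> irrelevant_ideal A G \<in> \<F> \<and>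
     (\<forall>I\<in>\<F>. I \<noteq> {\<zero>\<^bsub>A\<^esub>} \<longrightarrow>
        (\<exists>J\<in>\<F>. J \<subset> I \<and> (\<exists>x\<in>I. I = J <+>\<^bsub>A\<^esub> PIdl\<^bsub>A\<^esub> x) \<and> colon_ideal A J I \<in> \<F>))"


section \<open>Points of projective space\<close>

text \<open>
  The \<open>k\<close>-points of the projective space \<open>P^n\<close> with \<open>n + 1 = CARD('n)\<close> are the lines through the
  origin of \<open>'k ^ 'n\<close>. A linear subspace of \<open>P^n\<close> is given by a vector subspace \<open>W\<close>, a point lying on
  it iff the line is contained in \<open>W\<close>; \<open>W = {0}\<close> gives the empty subspace.
\<close>

definition proj_points :: "('k::field ^ 'n::finite) set set" where
  "proj_points = {vec.span {v} | v. v \<noteq> 0}"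

definition linear_sections :: "('k::field ^ 'n::finite) set set \<Rightarrow> ('k ^ 'n) set set set" where
  "linear_sections S = {{p \<in> S. p \<subseteq> W} | W. vec.subspace W}"

text \<open>
  Representatives of distinct points are distinct, hence \<open>r\<close> is injective on \<open>T\<close> and the set
  \<open>r ` T\<close> carries the same information as the family.
\<close>

definition linearly_independent_points :: "('k::field ^ 'n::finite) set set \<Rightarrow> bool" where
  "linearly_independent_points T \<longleftrightarrow>
     (\<exists>r. (\<forall>p\<in>T. r p \<noteq> 0 \<and> p = vec.span {r p}) \<and> vec.independent (r ` T))"


section \<open>The homogeneous coordinate ring\<close>

text \<open>Polynomials in variables indexed by \<open>'n\<close>; monomials are exponent functions.\<close>

type_synonym ('n, 'k) mpoly = "('n \<Rightarrow>\<^sub>0 nat) \<Rightarrow>\<^sub>0 'k"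

definition poly_eval :: "('n::finite, 'k::field) mpoly \<Rightarrow> 'k ^ 'n \<Rightarrow> 'k" where
  "poly_eval f v = (\<Sum>m\<in>Poly_Mapping.keys f. Poly_Mapping.lookup f m * (\<Prod>i\<in>UNIV. (v $ i) ^ Poly_Mapping.lookup m i))"

definition homogeneous :: "nat \<Rightarrow> ('n::finite, 'k::field) mpoly \<Rightarrow> bool" where
  "homogeneous d f \<longleftrightarrow> (\<forall>m\<in>Poly_Mapping.keys f. (\<Sum>i\<in>UNIV. Poly_Mapping.lookup m i) = d)"

definition vanishes_at :: "('n::finite, 'k::field) mpoly \<Rightarrow> ('k ^ 'n) set \<Rightarrow> bool" where
  "vanishes_at f p \<longleftrightarrow> (\<forall>v\<in>p. v \<noteq> 0 \<longrightarrow> poly_eval f v = 0)"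

abbreviation mpoly_ring :: "('n::finite, 'k::field) mpoly ring" where
  "mpoly_ring \<equiv> ring_of_type_algebra"

text \<open>
  For empty \<open>S\<close> every polynomial vanishes on \<open>S\<close>; the ideal generated by the variables is used
  instead, so that the coordinate ring of the empty set is \<open>k\<close>.
\<close>

definition vanishing_ideal :: "('k::field ^ 'n::finite) set set \<Rightarrow> ('n, 'k) mpoly set" where
  "vanishing_ideal S =
     (if S = {} then Idl\<^bsub>mpoly_ring\<^esub> {Poly_Mapping.single (Poly_Mapping.single i 1) 1 | i. True}
      else Idl\<^bsub>mpoly_ring\<^esub> {f. (\<exists>d. homogeneous d f) \<and> (\<forall>p\<in>S. vanishes_at f p)})"

definition coord_ring :: "('k::field ^ 'n::finite) set set \<Rightarrow> ('n, 'k) mpoly set ring" where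
  "coord_ring S = mpoly_ring Quot vanishing_ideal S"

definition coord_grading ::
  "('k::field ^ 'n::finite) set set \<Rightarrow> nat \<Rightarrow> ('n, 'k) mpoly set set" where
  "coord_grading S d = {vanishing_ideal S +>\<^bsub>mpoly_ring\<^esub> f | f. homogeneous d f}"

definition koszul_points :: "('k::field ^ 'n::finite) set set \<Rightarrow> bool" where
  "koszul_points S \<longleftrightarrow> koszul_algebra (coord_ring S) (coord_grading S)"

end

theory Submission
  imports Defs
begin

unbundle no fps_syntax

text \<open>
  Write \<open>A\<close> for the coordinate ring of \<open>S\<close> and \<open>I\<^sub>T\<close> for the ideal of \<open>A\<close> generated by the homogeneous
  elements of positive degree vanishing on \<open>T \<subseteq> S\<close>, so that \<open>I\<^sub>S = 0\<close> and \<open>I\<^sub>\<emptyset> = A_+\<close>.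

  Let \<open>T \<in> \<Lambda>\<close> differ from \<open>S\<close> and let \<open>T'\<close> be the independent set provided by the hypothesis. Restricting
  functions to \<open>T'\<close> identifies \<open>I\<^sub>T\<close> modulo \<open>I\<^sub>T\<^sub>\<union>\<^sub>T\<^sub>'\<close> with an ideal of the coordinate ring of \<open>T'\<close>, and as
  \<open>T'\<close> is independent, that ring is the full space of functions on \<open>T'\<close> in every positive degree. Since
  \<open>T\<close> is cut out in \<open>S\<close> by linear forms, the linear forms vanishing on \<open>T\<close> have no common zero in \<open>T'\<close>;
  multiplying them with linear forms dual to the points of \<open>T'\<close> gives everything of degree at least
  2. Hence \<open>I\<^sub>T\<close> is obtained from \<open>I\<^sub>T\<^sub>\<union>\<^sub>T\<^sub>'\<close> by adjoining finitely many linear forms (\<open>van_eq_adjoin\<close>). If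
  they are adjoined one at a time, the colon ideal at each step is \<open>I\<^sub>P\<close>, where \<open>P \<subseteq> T'\<close> consists of the
  points at which the new form is the first one not to vanish (\<open>adjoin_colon\<close>). The ideals \<open>I\<^sub>P\<close> in turn
  arise in the same way from \<open>I\<^sub>T\<^sub>'\<close>, by dropping the points of \<open>T' - P\<close> one after the other; the colon
  ideals are then the vanishing ideals of the single points dropped. All these ideals together,
  including the intermediate ones, form a Koszul filtration; \<open>linear_quotients\<close> is the abstract form
  of this construction.

  Koszulness follows by computing \<open>Tor\<^sup>A(A/I, k)\<close> for the ideals \<open>I\<close> of the filtration from a graded
  free resolution \<open>F\<close> of \<open>k\<close>, as the homology of \<open>F/IF\<close>. An induction over the filtration shows that
  it is concentrated on the diagonal (\<open>linear_quotients_acyclic\<close>); for \<open>I = A_+\<close> this is the claim.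
  Resolving \<open>k\<close> instead of the modules \<open>A/I\<close> has the effect that one and the same resolution serves
  all ideals, and that it may be arbitrary, so that no comparison of resolutions is required. A
  resolution of \<open>k\<close> with bases in the prescribed type is constructed in \<open>residue_resolution_exists\<close>.
\<close>

section \<open>Commutative graded rings\<close>

text \<open>
  The grading carries its projections \<open>pr m\<close> onto the components as data. That the sum of the
  components is direct is the content of \<open>pr_same\<close> and \<open>pr_other\<close>: an additive map which is the
  identity on one component and zero on the others reads off the coefficients of a decomposition.
\<close>

locale graded_cring = cring A for A :: "('a, 'c) ring_scheme" (structure) +
  fixes G :: "nat \<Rightarrow> 'a set" and pr :: "nat \<Rightarrow> 'a \<Rightarrow> 'a"
  assumes pr_in: "a \<in> carrier A \<Longrightarrow> pr m a \<in> G m"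
    and G_carrier: "a \<in> G m \<Longrightarrow> a \<in> carrier A"
    and pr_add: "\<lbrakk>a \<in> carrier A; b \<in> carrier A\<rbrakk> \<Longrightarrow> pr m (a \<oplus> b) = pr m a \<oplus> pr m b"
    and pr_same: "a \<in> G m \<Longrightarrow> pr m a = a"
    and pr_other: "\<lbrakk>a \<in> G n; m \<noteq> n\<rbrakk> \<Longrightarrow> pr m a = \<zero>"
    and G_mult: "\<lbrakk>a \<in> G m; b \<in> G n\<rbrakk> \<Longrightarrow> a \<otimes> b \<in> G (m + n)"
    and pr_sum: "a \<in> carrier A \<Longrightarrow> \<exists>d. a = (\<Oplus>m\<in>{..d}. pr m a)"
begin

lemma pr_closed [simp]: "a \<in> carrier A \<Longrightarrow> pr m a \<in> carrier A"
  by (rule G_carrier[OF pr_in])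

lemma pr_zero [simp]: "pr m \<zero> = \<zero>"
proof -
  have "pr m \<zero> \<oplus> pr m \<zero> = pr m \<zero>"
    using pr_add[of \<zero> \<zero> m] by simp
  then show ?thesis
    using add.l_cancel_one[of "pr m \<zero>" "pr m \<zero>"] by simp
qed

lemma G_zero [simp]: "\<zero> \<in> G m"
  using pr_in[OF zero_closed] by simp

lemma G_add: "\<lbrakk>a \<in> G m; b \<in> G m\<rbrakk> \<Longrightarrow> a \<oplus> b \<in> G m"
  using pr_add[of a b m] pr_in[of "a \<oplus> b" m] G_carrier[of a m] G_carrier[of b m]
  by (simp add: pr_same)

lemma homogeneous_induct [consumes 1, case_names zero add]:
  assumes "a \<in> carrier A" and "P \<zero>"
    and step: "\<And>b h m. \<lbrakk>b \<in> carrier A; P b; h \<in> G m\<rbrakk> \<Longrightarrow> P (b \<oplus> h)"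
  shows "P a"
proof -
  obtain d where d: "a = (\<Oplus>m\<in>{..d}. pr m a)"
    using pr_sum assms(1) by blast
  have "P (\<Oplus>m\<in>{..n}. pr m a)" for n
  proof (induction n)
    case 0
    show ?case
      using step[of \<zero> "pr 0 a" 0] assms(1,2) pr_in by simp
  next
    case (Suc n)
    have "(\<Oplus>m\<in>{..Suc n}. pr m a) = (\<Oplus>m\<in>{..n}. pr m a) \<oplus> pr (Suc n) a"
      using assms(1) by (simp add: a_comm)
    then show ?case
      using step[OF _ Suc pr_in[OF assms(1), of "Suc n"]] assms(1) by simp
  qed
  then show ?thesis
    using d by metis
qed

text \<open>Multiplication by a homogeneous element of degree \<open>m\<close> shifts the components by \<open>m\<close>.\<close>

lemma pr_mult:
  assumes x: "x \<in> G m" and a: "a \<in> carrier A"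
  shows "pr n (x \<otimes> a) = (if m \<le> n then x \<otimes> pr (n - m) a else \<zero>)"
  using a
proof (induction rule: homogeneous_induct)
  case zero
  show ?case using x G_carrier by simp
next
  case (add b h k)
  have c: "x \<in> carrier A" "h \<in> carrier A" using x add G_carrier by auto
  have xh: "pr n (x \<otimes> h) = (if m \<le> n then x \<otimes> pr (n - m) h else \<zero>)"
  proof (cases "n = m + k")
    case True
    then show ?thesis using G_mult[OF x add(2)] pr_same add(2) by simp
  next
    case False
    then have "m \<le> n \<Longrightarrow> n - m \<noteq> k" by auto
    then show ?thesis
      using pr_other[OF G_mult[OF x add(2)], of n] pr_other[OF add(2), of "n - m"] False c
      by simp
  qed
  have "pr n (x \<otimes> (b \<oplus> h)) = pr n (x \<otimes> b) \<oplus> pr n (x \<otimes> h)"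
    using c add by (simp add: r_distr pr_add)
  then show ?case
    using xh add c by (simp add: pr_add r_distr)
qed

lemma irrelevant_ideal_eq: "irrelevant_ideal A G = {a \<in> carrier A. pr 0 a = \<zero>}"
proof (intro equalityI subsetI)
  fix a assume "a \<in> irrelevant_ideal A G"
  then obtain f d where a: "a = finsum A f {1..d}" and f: "\<forall>m\<in>{1..d}. f m \<in> G m"
    unfolding irrelevant_ideal_def by blast
  have "n \<le> d \<Longrightarrow> finsum A f {1..n} \<in> carrier A \<and> pr 0 (finsum A f {1..n}) = \<zero>" for n
  proof (induction n)
    case (Suc n)
    have fc: "f \<in> {1..Suc n} \<rightarrow> carrier A"
      using f Suc.prems by (intro Pi_I G_carrier) auto
    then have "f \<in> {1..n} \<rightarrow> carrier A" "f (Suc n) \<in> carrier A" by auto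
    then have "finsum A f {1..Suc n} = f (Suc n) \<oplus> finsum A f {1..n}"
      by (simp add: atLeastAtMostSuc_conv)
    moreover have "pr 0 (f (Suc n)) = \<zero>"
      using f Suc.prems pr_other[of "f (Suc n)" "Suc n" 0] by auto
    ultimately show ?case
      using Suc \<open>f (Suc n) \<in> carrier A\<close> by (simp add: pr_add)
  qed auto
  then show "a \<in> {a \<in> carrier A. pr 0 a = \<zero>}" using a by auto
next
  fix a assume a: "a \<in> {a \<in> carrier A. pr 0 a = \<zero>}"
  then obtain d where d: "a = (\<Oplus>m\<in>{..d}. pr m a)"
    using pr_sum by blast
  have "(\<Oplus>m\<in>{..d}. pr m a) = pr 0 a \<oplus> (\<Oplus>m\<in>{Suc 0..d}. pr m a)"
    using a by (intro add.finprod_0'[symmetric]) auto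
  also have "\<dots> = (\<Oplus>m\<in>{1..d}. pr m a)" using a by auto
  finally have "a = (\<Oplus>m\<in>{1..d}. pr m a)" using d by simp
  moreover have "\<forall>m\<in>{1..d}. pr m a \<in> G m" using a pr_in by blast
  ultimately show "a \<in> irrelevant_ideal A G"
    unfolding irrelevant_ideal_def by blast
qed

lemma irrelevant_ideal_ideal: "ideal (irrelevant_ideal A G) A"
proof -
  let ?I = "{a \<in> carrier A. pr 0 a = \<zero>}"
  have mult: "pr 0 (b \<otimes> a) = \<zero>" if "a \<in> carrier A" "pr 0 a = \<zero>" "b \<in> carrier A" for a b
    using that(3)
  proof (induction rule: homogeneous_induct)
    case zero
    show ?case using that by simp
  next
    case (add c h m)
    then show ?case
      using that G_carrier[OF add(2)] pr_mult[OF add(2) that(1), of 0]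
      by (cases m) (auto simp: l_distr pr_add)
  qed
  have neg: "pr 0 (\<ominus> a) = \<zero>" if "a \<in> carrier A" "pr 0 a = \<zero>" for a
    using mult[OF that, of "\<ominus> \<one>"] that by (simp add: l_minus)
  have mult': "pr 0 (a \<otimes> b) = \<zero>" if "a \<in> carrier A" "pr 0 a = \<zero>" "b \<in> carrier A" for a b
    using mult[OF that] that by (simp add: m_comm)
  have "ideal ?I A"
  proof (rule idealI[OF ring_axioms])
    show "subgroup ?I (add_monoid A)"
      by (rule add.subgroupI) (auto simp: pr_add neg a_inv_def[symmetric])
  qed (auto simp: mult mult')
  then show ?thesis by (simp add: irrelevant_ideal_eq)
qed

end

section \<open>Graded free modules\<close>

lemma free_module_simps:
  "\<zero>\<^bsub>free_module A B\<^esub> = (\<lambda>_. \<zero>\<^bsub>A\<^esub>)"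
  "u \<oplus>\<^bsub>free_module A B\<^esub> v = (\<lambda>x. u x \<oplus>\<^bsub>A\<^esub> v x)"
  "a \<odot>\<^bsub>free_module A B\<^esub> v = (\<lambda>x. a \<otimes>\<^bsub>A\<^esub> v x)"
  by (simp_all add: free_module_def)

lemma free_module_carrier:
  "u \<in> carrier (free_module A B) \<longleftrightarrow>
     (\<forall>x\<in>B. u x \<in> carrier A) \<and> (\<forall>x. x \<notin> B \<longrightarrow> u x = \<zero>\<^bsub>A\<^esub>) \<and> finite {x. u x \<noteq> \<zero>\<^bsub>A\<^esub>}"
  by (simp add: free_module_def)

context cring
begin

lemma free_module_coord:
  "u \<in> carrier (free_module R B) \<Longrightarrow> u x \<in> carrier R"
  by (cases "x \<in> B") (auto simp: free_module_carrier)

lemma free_module_module: "module R (free_module R B)"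
proof -
  have c: "u x \<in> carrier R" if "u \<in> carrier (free_module R B)" for u x
    using that by (rule free_module_coord)
  have add: "(\<lambda>x. u x \<oplus> v x) \<in> carrier (free_module R B)"
    if u: "u \<in> carrier (free_module R B)" and v: "v \<in> carrier (free_module R B)" for u v
  proof -
    have "{x. u x \<oplus> v x \<noteq> \<zero>} \<subseteq> {x. u x \<noteq> \<zero>} \<union> {x. v x \<noteq> \<zero>}" by auto
    then have "finite {x. u x \<oplus> v x \<noteq> \<zero>}"
      using u v unfolding free_module_carrier by (meson finite_UnI finite_subset)
    then show ?thesis
      using u v unfolding free_module_carrier by auto
  qed
  have smult: "(\<lambda>x. a \<otimes> u x) \<in> carrier (free_module R B)"
    if a: "a \<in> carrier R" and u: "u \<in> carrier (free_module R B)" for a u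
  proof -
    have "{x. a \<otimes> u x \<noteq> \<zero>} \<subseteq> {x. u x \<noteq> \<zero>}" using a by auto
    then have "finite {x. a \<otimes> u x \<noteq> \<zero>}"
      using u unfolding free_module_carrier by (meson finite_subset)
    then show ?thesis
      using u a unfolding free_module_carrier by auto
  qed
  show ?thesis
  proof (rule moduleI)
    show "cring R" by (rule is_cring)
    show "abelian_group (free_module R B)"
    proof (rule abelian_groupI)
      fix u assume u: "u \<in> carrier (free_module R B)"
      have "(\<lambda>x. \<ominus> \<one> \<otimes> u x) \<in> carrier (free_module R B)"
        using smult[OF _ u] by simp
      moreover have "(\<lambda>x. \<ominus> \<one> \<otimes> u x) \<oplus>\<^bsub>free_module R B\<^esub> u = \<zero>\<^bsub>free_module R B\<^esub>"
        using c[OF u] by (simp add: free_module_simps l_minus l_neg)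
      ultimately show "\<exists>v\<in>carrier (free_module R B). v \<oplus>\<^bsub>free_module R B\<^esub> u = \<zero>\<^bsub>free_module R B\<^esub>"
        by blast
    next
      fix u v assume "u \<in> carrier (free_module R B)" "v \<in> carrier (free_module R B)"
      then show "u \<oplus>\<^bsub>free_module R B\<^esub> v = v \<oplus>\<^bsub>free_module R B\<^esub> u"
        using c by (simp add: free_module_simps a_comm)
    qed (use c add in \<open>simp_all add: free_module_simps a_assoc free_module_carrier\<close>)
  qed (use c smult in \<open>simp_all add: free_module_simps l_distr r_distr m_assoc\<close>)
qed

end

lemma (in abelian_monoid) finsum_in:
  assumes "\<zero> \<in> K" "\<And>x y. \<lbrakk>x \<in> K; y \<in> K\<rbrakk> \<Longrightarrow> x \<oplus> y \<in> K" "K \<subseteq> carrier G"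
    and "\<And>i. i \<in> I \<Longrightarrow> f i \<in> K"
  shows "finsum G f I \<in> K"
  using assms(4)
proof (induction I rule: infinite_finite_induct)
  case (insert i I)
  then have "f \<in> I \<rightarrow> carrier G" "f i \<in> carrier G" using assms(3) by auto
  then show ?case using insert assms by simp
qed (use assms in auto)

lemma (in cring) free_module_update:
  assumes "v \<in> carrier (free_module R B)" "x \<in> B" "a \<in> carrier R"
  shows "v(x := a) \<in> carrier (free_module R B)"
proof -
  have "{y. (v(x := a)) y \<noteq> \<zero>} \<subseteq> insert x {y. v y \<noteq> \<zero>}" by auto
  moreover have "finite (insert x {y. v y \<noteq> \<zero>})"
    using assms(1) by (simp add: free_module_carrier)
  ultimately have "finite {y. (v(x := a)) y \<noteq> \<zero>}" by (rule finite_subset)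
  then show ?thesis using assms unfolding free_module_carrier by auto
qed

lemma (in cring) free_support_induct [consumes 1, case_names zero update]:
  assumes v: "v \<in> carrier (free_module R B)" and zero: "P (\<lambda>_. \<zero>)"
    and update: "\<And>v x a. \<lbrakk>v \<in> carrier (free_module R B); P v; x \<in> B; v x = \<zero>; a \<in> carrier R\<rbrakk>
      \<Longrightarrow> P (v(x := a))"
  shows "P v"
proof -
  have "\<lbrakk>v \<in> carrier (free_module R B); {x. v x \<noteq> \<zero>} \<subseteq> C\<rbrakk> \<Longrightarrow> P v" if "finite C" for C v
    using that
  proof (induction C arbitrary: v rule: finite_induct)
    case empty
    then have "v = (\<lambda>_. \<zero>)" by auto
    then show ?case using zero by simp
  next
    case (insert x C)
    show ?case
    proof (cases "x \<in> B")
      case False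
      then have "v x = \<zero>" using insert.prems by (simp add: free_module_carrier)
      then show ?thesis using insert by auto
    next
      case True
      have c: "v(x := \<zero>) \<in> carrier (free_module R B)"
        by (rule free_module_update[OF insert.prems(1) True zero_closed])
      have "{y. (v(x := \<zero>)) y \<noteq> \<zero>} \<subseteq> C" using insert.prems by auto
      then have "P (v(x := \<zero>))" using insert.IH[OF c] by blast
      from update[OF c this True _ free_module_coord[OF insert.prems(1), of x]] show ?thesis
        by simp
    qed
  qed
  then show ?thesis
    using v by (auto simp: free_module_carrier)
qed

lemma (in cring) free_module_single:
  "\<lbrakk>x \<in> B; a \<in> carrier R\<rbrakk> \<Longrightarrow> (\<lambda>y. if y = x then a else \<zero>) \<in> carrier (free_module R B)"
  by (auto simp: free_module_carrier)

lemma graded_homD: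
  assumes "f \<in> graded_hom A M N M' N'"
  shows "u \<in> carrier M \<Longrightarrow> f u \<in> carrier M'"
    and "\<lbrakk>u \<in> carrier M; v \<in> carrier M\<rbrakk> \<Longrightarrow> f (u \<oplus>\<^bsub>M\<^esub> v) = f u \<oplus>\<^bsub>M'\<^esub> f v"
    and "\<lbrakk>a \<in> carrier A; u \<in> carrier M\<rbrakk> \<Longrightarrow> f (a \<odot>\<^bsub>M\<^esub> u) = a \<odot>\<^bsub>M'\<^esub> f u"
    and "u \<in> N j \<Longrightarrow> f u \<in> N' j"
  using assms unfolding graded_hom_def by (auto simp: image_subset_iff)

context graded_cring
begin

abbreviation FM :: "'b set \<Rightarrow> ('a, 'b \<Rightarrow> 'a) module" where
  "FM B \<equiv> free_module A B"

definition free_pr :: "'b set \<Rightarrow> ('b \<Rightarrow> nat) \<Rightarrow> nat \<Rightarrow> ('b \<Rightarrow> 'a) \<Rightarrow> 'b \<Rightarrow> 'a" where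
  "free_pr B \<delta> j v x = (if x \<in> B \<and> \<delta> x \<le> j then pr (j - \<delta> x) (v x) else \<zero>)"

text \<open>
  The degree \<open>j\<close> part of \<open>v\<close> has the degree \<open>j - \<delta> x\<close> part of \<open>v x\<close> as its coordinate at \<open>x\<close>. The
  subtraction truncates, so the coordinates with \<open>\<delta> x > j\<close> are set to zero separately.
\<close>

lemma free_pr_in:
  assumes "v \<in> carrier (FM B)"
  shows "free_pr B \<delta> j v \<in> free_grading A G B \<delta> j"
proof -
  have "v x \<in> carrier A" for x using free_module_coord[OF assms] .
  moreover have "{x. free_pr B \<delta> j v x \<noteq> \<zero>} \<subseteq> {x. v x \<noteq> \<zero>}"
    by (auto simp: free_pr_def)
  then have "finite {x. free_pr B \<delta> j v x \<noteq> \<zero>}"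
    using assms by (auto simp: free_module_carrier intro: finite_subset)
  ultimately show ?thesis
    using assms pr_in unfolding free_grading_def free_module_carrier
    by (auto simp: free_pr_def)
qed

lemma free_grading_closed: "v \<in> free_grading A G B \<delta> j \<Longrightarrow> v \<in> carrier (FM B)"
  by (simp add: free_grading_def)

lemma free_pr_closed: "v \<in> carrier (FM B) \<Longrightarrow> free_pr B \<delta> j v \<in> carrier (FM B)"
  by (intro free_grading_closed[OF free_pr_in])

lemma free_pr_zero: "free_pr B \<delta> j (\<lambda>_. \<zero>) = (\<lambda>_. \<zero>)"
  by (auto simp: free_pr_def fun_eq_iff)

lemma free_pr_add:
  assumes "u \<in> carrier (FM B)" "v \<in> carrier (FM B)"
  shows "free_pr B \<delta> j (u \<oplus>\<^bsub>FM B\<^esub> v) = free_pr B \<delta> j u \<oplus>\<^bsub>FM B\<^esub> free_pr B \<delta> j v"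
  using free_module_coord[OF assms(1)] free_module_coord[OF assms(2)]
  by (auto simp: free_pr_def fun_eq_iff free_module_simps pr_add)

lemma free_pr_homogeneous:
  assumes "v \<in> free_grading A G B \<delta> j"
  shows "free_pr B \<delta> k v = (if k = j then v else (\<lambda>_. \<zero>))"
proof
  fix x
  have v: "x \<notin> B \<Longrightarrow> v x = \<zero>" "x \<in> B \<Longrightarrow> \<delta> x \<le> j \<Longrightarrow> v x \<in> G (j - \<delta> x)"
      "x \<in> B \<Longrightarrow> \<not> \<delta> x \<le> j \<Longrightarrow> v x = \<zero>"
    using assms by (auto simp: free_grading_def free_module_carrier split: if_splits)
  show "free_pr B \<delta> k v x = (if k = j then v else (\<lambda>_. \<zero>)) x"
  proof (cases "x \<in> B \<and> \<delta> x \<le> j")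
    case True
    then show ?thesis
      using v(2) pr_same[of "v x"] pr_other[of "v x" "j - \<delta> x" "k - \<delta> x"]
      by (auto simp: free_pr_def)
  next
    case False
    then have "v x = \<zero>" using v by blast
    then show ?thesis using False by (simp add: free_pr_def)
  qed
qed

lemma free_homogeneous_induct [consumes 1, case_names zero add]:
  assumes v: "v \<in> carrier (FM B)" and zero: "P (\<lambda>_. \<zero>)"
    and add: "\<And>v h j. \<lbrakk>v \<in> carrier (FM B); P v; h \<in> free_grading A G B \<delta> j\<rbrakk>
      \<Longrightarrow> P (v \<oplus>\<^bsub>FM B\<^esub> h)"
  shows "P v"
  using v
proof (induction rule: free_support_induct)
  case zero
  show ?case by (rule assms(2))
next
  case (update v x a)
  note v = update(1) and x = update(2) and vx = update(3) and Pv = update(5)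
  have c: "v(x := b) \<in> carrier (FM B)" if "b \<in> carrier A" for b
    by (rule free_module_update[OF v x that])
  show ?case
    using update(4)
  proof (induction rule: homogeneous_induct)
    case zero
    have "v(x := \<zero>) = v" using vx by auto
    then show ?case using Pv by simp
  next
    case (add b h m)
    have h: "(\<lambda>y. if y = x then h else \<zero>) \<in> free_grading A G B \<delta> (m + \<delta> x)"
      using free_module_single[OF x G_carrier[OF add(2)]] add(2)
      by (auto simp: free_grading_def)
    have "v(x := b) \<oplus>\<^bsub>FM B\<^esub> (\<lambda>y. if y = x then h else \<zero>) = v(x := b \<oplus> h)"
      using free_module_coord[OF v] by (auto simp: free_module_simps fun_eq_iff)
    then show ?case
      using assms(3)[OF c[OF add(1)] add(3) h] by (simp only:)
  qed
qed

lemma free_hom_zero: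
  assumes "f \<in> graded_hom A (FM B') N' (FM B) N"
  shows "f (\<lambda>_. \<zero>) = (\<lambda>_. \<zero>)"
proof -
  interpret M': module A "FM B'" by (rule free_module_module)
  interpret M: module A "FM B" by (rule free_module_module)
  have "f (\<zero> \<odot>\<^bsub>FM B'\<^esub> \<zero>\<^bsub>FM B'\<^esub>) = \<zero> \<odot>\<^bsub>FM B\<^esub> f \<zero>\<^bsub>FM B'\<^esub>"
    using graded_homD(3)[OF assms] by blast
  then show ?thesis
    using graded_homD(1)[OF assms M'.zero_closed] M'.smult_l_null[OF M'.zero_closed]
    by (simp add: free_module_simps(1))
qed

lemma free_hom_pr:
  assumes f: "f \<in> graded_hom A (FM B') (free_grading A G B' \<delta>') (FM B) (free_grading A G B \<delta>)"
    and v: "v \<in> carrier (FM B')"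
  shows "f (free_pr B' \<delta>' j v) = free_pr B \<delta> j (f v)"
  using v
proof (induction rule: free_homogeneous_induct[where \<delta> = \<delta>'])
  case zero
  show ?case by (simp add: free_pr_zero free_hom_zero[OF f])
next
  case (add v h k)
  have h: "h \<in> carrier (FM B')" "f h \<in> free_grading A G B \<delta> k"
    using add graded_homD(4)[OF f] free_grading_closed by blast+
  have hh: "f (free_pr B' \<delta>' j h) = free_pr B \<delta> j (f h)"
    by (simp add: free_pr_homogeneous[OF add(2)] free_pr_homogeneous[OF h(2)] free_hom_zero[OF f])
  have "f (free_pr B' \<delta>' j (v \<oplus>\<^bsub>FM B'\<^esub> h)) =
      f (free_pr B' \<delta>' j v) \<oplus>\<^bsub>FM B\<^esub> f (free_pr B' \<delta>' j h)"
    using add h by (simp add: free_pr_add free_pr_closed graded_homD(2)[OF f])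
  also have "\<dots> = free_pr B \<delta> j (f v \<oplus>\<^bsub>FM B\<^esub> f h)"
    using add h hh graded_homD(1)[OF f] by (simp add: free_pr_add)
  finally show ?case using add h by (simp add: graded_homD(2)[OF f])
qed

text \<open>
  This says that a module map sends \<open>I F'\<close> into \<open>I F\<close>: the image of \<open>v\<close> is the combination, with the
  coordinates of \<open>v\<close> as coefficients, of the images of the basis elements.
\<close>

lemma free_hom_ideal:
  assumes f: "f \<in> graded_hom A (FM B') N' (FM B) N" and I: "ideal I A"
    and v: "v \<in> carrier (FM B')" and vI: "\<forall>x. v x \<in> I"
  shows "f v y \<in> I"
  using v vI
proof (induction rule: free_support_induct)
  case zero
  interpret ideal I A by (rule I)
  show ?case by (simp add: free_hom_zero[OF f])
next
  case (update v x a)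
  interpret I: ideal I A by (rule I)
  let ?e = "\<lambda>y. if y = x then \<one> else \<zero>"
  have e: "?e \<in> carrier (FM B')" using update by (intro free_module_single) auto
  have ae: "a \<odot>\<^bsub>FM B'\<^esub> ?e \<in> carrier (FM B')"
    using module.smult_closed[OF free_module_module] e update by blast
  have aI: "a \<in> I" using update.prems by (metis fun_upd_same)
  have "v z \<in> I" for z
    using update.prems I.zero_closed \<open>v x = \<zero>\<close> by (cases "z = x") (auto dest: spec[of _ z])
  then have fv: "f v y \<in> I" using update by blast
  have "v(x := a) = v \<oplus>\<^bsub>FM B'\<^esub> a \<odot>\<^bsub>FM B'\<^esub> ?e"
    using free_module_coord[OF update(1)] update(3,4) by (auto simp: free_module_simps fun_eq_iff)
  then have "f (v(x := a)) = f v \<oplus>\<^bsub>FM B\<^esub> a \<odot>\<^bsub>FM B\<^esub> f ?e"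
    using update e ae by (simp add: graded_homD(2,3)[OF f])
  then have eq: "f (v(x := a)) y = f v y \<oplus> a \<otimes> f ?e y"
    by (simp add: free_module_simps)
  have "f ?e y \<in> carrier A"
    using graded_homD(1)[OF f e] by (rule free_module_coord)
  then show ?case
    unfolding eq using fv aI I.I_r_closed I.a_closed by blast
qed

lemma free_decomposition:
  assumes v: "v \<in> carrier (FM B)"
  shows "\<exists>d. v = (\<Oplus>\<^bsub>FM B\<^esub>j\<in>{..d}. free_pr B \<delta> j v)"
proof -
  interpret M: module A "FM B" by (rule free_module_module)
  have "\<exists>d. \<forall>n\<ge>d. v = (\<Oplus>\<^bsub>FM B\<^esub>j\<in>{..n}. free_pr B \<delta> j v)"
    using v
  proof (induction rule: free_homogeneous_induct[where \<delta> = \<delta>])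
    case zero
    have "(\<Oplus>\<^bsub>FM B\<^esub>j\<in>{..n}. \<zero>\<^bsub>FM B\<^esub>) = \<zero>\<^bsub>FM B\<^esub>" for n :: nat
      by (rule M.finsum_zero)
    then show ?case by (simp add: free_pr_zero free_module_simps(1))
  next
    case (add v h k)
    then obtain d where d: "\<And>n. n \<ge> d \<Longrightarrow> (\<Oplus>\<^bsub>FM B\<^esub>j\<in>{..n}. free_pr B \<delta> j v) = v"
      by metis
    have h: "h \<in> carrier (FM B)" using add free_grading_closed by blast
    have "(\<Oplus>\<^bsub>FM B\<^esub>j\<in>{..n}. free_pr B \<delta> j (v \<oplus>\<^bsub>FM B\<^esub> h)) = v \<oplus>\<^bsub>FM B\<^esub> h"
      if n: "n \<ge> max d k" for n
    proof -
      have "(\<Oplus>\<^bsub>FM B\<^esub>j\<in>{..n}. free_pr B \<delta> j h) =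
          (\<Oplus>\<^bsub>FM B\<^esub>j\<in>{..n}. if k = j then h else \<zero>\<^bsub>FM B\<^esub>)"
        using h M.zero_closed
        by (intro M.finsum_cong') (auto simp: free_pr_homogeneous[OF add(2)] free_module_simps(1))
      also have "\<dots> = h"
        using M.finsum_singleton[of k "{..n}" "\<lambda>_. h"] n h by simp
      finally have hh: "(\<Oplus>\<^bsub>FM B\<^esub>j\<in>{..n}. free_pr B \<delta> j h) = h" .
      have "(\<Oplus>\<^bsub>FM B\<^esub>j\<in>{..n}. free_pr B \<delta> j (v \<oplus>\<^bsub>FM B\<^esub> h)) =
          (\<Oplus>\<^bsub>FM B\<^esub>j\<in>{..n}. free_pr B \<delta> j v \<oplus>\<^bsub>FM B\<^esub> free_pr B \<delta> j h)"
        using add h by (simp add: free_pr_add)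
      also have "\<dots> = (\<Oplus>\<^bsub>FM B\<^esub>j\<in>{..n}. free_pr B \<delta> j v) \<oplus>\<^bsub>FM B\<^esub> (\<Oplus>\<^bsub>FM B\<^esub>j\<in>{..n}. free_pr B \<delta> j h)"
        using add h by (intro M.finsum_addf) (auto simp: free_pr_closed)
      finally show ?thesis using d n hh by simp
    qed
    then show ?case by metis
  qed
  then show ?thesis by blast
qed

end

section \<open>Existence of graded free resolutions\<close>

text \<open>
  A function of finite support is determined by a list enumerating the pairs \<open>(x, u x)\<close> in its
  graph, and an infinite type absorbs pairs and hence lists of a given length. This bound on the
  number of elements of a free module is what lets one fixed type supply the bases of all terms of
  a resolution.
\<close>

lemma finite_support_injection:
  assumes "infinite (UNIV :: 'b set)" and \<iota>: "inj (\<iota> :: 'a \<Rightarrow> 'b)" and \<nu>: "inj (\<nu> :: nat \<Rightarrow> 'b)"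
  shows "\<exists>enc :: nat \<times> ('b \<Rightarrow> 'a) \<Rightarrow> 'b. inj_on enc {(j, u). finite {x. u x \<noteq> z}}"
proof -
  obtain p0 where "bij_betw p0 ((UNIV :: 'b set) \<times> (UNIV :: 'b set)) (UNIV :: 'b set)"
    using iffD2[OF card_of_ordIso card_of_Times_same_infinite[OF assms(1)]] by auto
  then have p0: "inj p0" by (simp add: bij_betw_def)
  define p where "p x y = p0 (x, y)" for x y
  have p: "p x y = p x' y' \<longleftrightarrow> x = x' \<and> y = y'" for x y x' y'
    using p0 unfolding p_def inj_def by blast
  define le where "le = foldr (\<lambda>(x, a) b. p (p x (\<iota> a)) b)"
  have le: "le xs b = le ys b \<Longrightarrow> length xs = length ys \<Longrightarrow> xs = ys" for xs ys b
  proof (induction xs arbitrary: ys)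
    case (Cons x xs)
    then obtain y ys' where ys: "ys = y # ys'" by (cases ys) auto
    obtain x1 x2 y1 y2 where xy: "x = (x1, x2)" "y = (y1, y2)" by fastforce
    show ?case
      using Cons.prems Cons.IH[of ys'] inj_eq[OF \<iota>] unfolding ys xy
      by (auto simp: le_def p)
  qed auto
  define lst where "lst u = (SOME xs. set xs = {(x, u x) | x. u x \<noteq> z})" for u :: "'b \<Rightarrow> 'a"
  have lst: "set (lst u) = {(x, u x) | x. u x \<noteq> z}" if "finite {x. u x \<noteq> z}" for u
  proof -
    have "finite ((\<lambda>x. (x, u x)) ` {x. u x \<noteq> z})" using that by simp
    moreover have "(\<lambda>x. (x, u x)) ` {x. u x \<noteq> z} = {(x, u x) | x. u x \<noteq> z}" by auto
    ultimately have "\<exists>xs. set xs = {(x, u x) | x. u x \<noteq> z}" using finite_list by metis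
    then show ?thesis unfolding lst_def by (rule someI_ex)
  qed
  define enc where "enc = (\<lambda>(j, u). p (\<nu> j) (p (\<nu> (length (lst u))) (le (lst u) (\<nu> 0))))"
  have "(j, u) = (k, v)"
    if f: "finite {x. u x \<noteq> z}" "finite {x. v x \<noteq> z}" and e: "enc (j, u) = enc (k, v)" for j k u v
  proof -
    have jk: "j = k" using e inj_eq[OF \<nu>] by (simp add: enc_def p)
    have "lst u = lst v"
      using e inj_eq[OF \<nu>] by (intro le) (auto simp: enc_def p)
    then have "{(x, u x) | x. u x \<noteq> z} = {(x, v x) | x. v x \<noteq> z}"
      using lst[OF f(1)] lst[OF f(2)] by simp
    then have "(x, y) \<in> {(x, u x) | x. u x \<noteq> z} \<longleftrightarrow> (x, y) \<in> {(x, v x) | x. v x \<noteq> z}" for x y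
      by simp
    then have uv: "u x \<noteq> z \<and> u x = y \<longleftrightarrow> v x \<noteq> z \<and> v x = y" for x y by auto
    have "u x = v x" for x
      using uv[of x "u x"] uv[of x "v x"] by (cases "u x = z") auto
    then have "u = v" by auto
    then show ?thesis using jk by simp
  qed
  then have "inj_on enc {(j, u). finite {x. u x \<noteq> z}}"
    unfolding inj_on_def by blast
  then show ?thesis by blast
qed

context graded_cring
begin

definition graded_submodule :: "'b set \<Rightarrow> ('b \<Rightarrow> nat) \<Rightarrow> ('b \<Rightarrow> 'a) set \<Rightarrow> bool" where
  "graded_submodule B \<delta> Z \<longleftrightarrow>
     Z \<subseteq> carrier (FM B) \<and> \<zero>\<^bsub>FM B\<^esub> \<in> Z \<and>
     (\<forall>u\<in>Z. \<forall>v\<in>Z. u \<oplus>\<^bsub>FM B\<^esub> v \<in> Z) \<and>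
     (\<forall>a\<in>carrier A. \<forall>u\<in>Z. a \<odot>\<^bsub>FM B\<^esub> u \<in> Z) \<and>
     (\<forall>u\<in>Z. \<forall>j. free_pr B \<delta> j u \<in> Z)"

lemma free_grading_add:
  assumes "u \<in> free_grading A G B \<delta> j" "v \<in> free_grading A G B \<delta> j"
  shows "u \<oplus>\<^bsub>FM B\<^esub> v \<in> free_grading A G B \<delta> j"
proof -
  interpret M: module A "FM B" by (rule free_module_module)
  have "u \<oplus>\<^bsub>FM B\<^esub> v \<in> carrier (FM B)"
    using assms free_grading_closed by blast
  moreover have "u x \<oplus> v x \<in> (if \<delta> x \<le> j then G (j - \<delta> x) else {\<zero>})" if "x \<in> B" for x
    using assms that G_add[of "u x" "j - \<delta> x" "v x"] unfolding free_grading_def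
    by (cases "\<delta> x \<le> j") force+
  ultimately show ?thesis by (simp add: free_grading_def free_module_simps)
qed

lemma free_grading_zero: "\<zero>\<^bsub>FM B\<^esub> \<in> free_grading A G B \<delta> j"
  by (auto simp: free_grading_def free_module_simps free_module_carrier)

lemma free_grading_smult:
  assumes "a \<in> G i" "v \<in> free_grading A G B \<delta> j"
  shows "a \<odot>\<^bsub>FM B\<^esub> v \<in> free_grading A G B \<delta> (i + j)"
proof -
  interpret M: module A "FM B" by (rule free_module_module)
  have a: "a \<in> carrier A" using assms(1) by (rule G_carrier)
  then have c: "a \<odot>\<^bsub>FM B\<^esub> v \<in> carrier (FM B)"
    using assms(2) by (blast intro: free_grading_closed)
  have "(a \<odot>\<^bsub>FM B\<^esub> v) x \<in> (if \<delta> x \<le> i + j then G (i + j - \<delta> x) else {\<zero>})" if x: "x \<in> B" for x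
  proof (cases "\<delta> x \<le> j")
    case True
    then have "v x \<in> G (j - \<delta> x)" using assms(2) x by (auto simp: free_grading_def)
    then have "a \<otimes> v x \<in> G (i + (j - \<delta> x))" using assms(1) G_mult by blast
    then show ?thesis using True by (simp add: free_module_simps)
  next
    case False
    then have "v x = \<zero>" using assms(2) x by (auto simp: free_grading_def)
    then show ?thesis using a by (simp add: free_module_simps)
  qed
  then show ?thesis using c by (simp add: free_grading_def)
qed

text \<open>
  The covering free module takes every homogeneous element of \<open>Z\<close> as a generator, in its own
  degree; it is surjective because \<open>Z\<close> contains the homogeneous parts of its elements. The pairs
  \<open>(degree, element)\<close> are turned into names of basis elements by \<open>enc\<close>.
\<close>

lemma graded_cover:
  fixes enc :: "nat \<times> ('b \<Rightarrow> 'a) \<Rightarrow> 'b" and B :: "'b set"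
  assumes enc: "inj_on enc {(j, u). finite {x. u x \<noteq> \<zero>}}"
    and Z: "graded_submodule B \<delta> Z"
  shows "\<exists>(B' :: 'b set) \<delta>'. \<exists>\<phi>\<in>graded_hom A (FM B') (free_grading A G B' \<delta>') (FM B) (free_grading A G B \<delta>).
           \<phi> ` carrier (FM B') = Z"
proof -
  interpret M: module A "FM B" by (rule free_module_module)
  have Zc: "Z \<subseteq> carrier (FM B)" and Z0: "\<zero>\<^bsub>FM B\<^esub> \<in> Z"
    and Zadd: "\<And>u v. \<lbrakk>u \<in> Z; v \<in> Z\<rbrakk> \<Longrightarrow> u \<oplus>\<^bsub>FM B\<^esub> v \<in> Z"
    and Zsm: "\<And>a u. \<lbrakk>a \<in> carrier A; u \<in> Z\<rbrakk> \<Longrightarrow> a \<odot>\<^bsub>FM B\<^esub> u \<in> Z"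
    and Zpr: "\<And>u j. u \<in> Z \<Longrightarrow> free_pr B \<delta> j u \<in> Z"
    using Z unfolding graded_submodule_def by auto
  define H where "H = {(j, u). u \<in> Z \<and> u \<in> free_grading A G B \<delta> j}"
  have "H \<subseteq> {(j, u). finite {x. u x \<noteq> \<zero>}}"
    using Zc by (auto simp: H_def free_module_carrier)
  then have injH: "inj_on enc H" using enc inj_on_subset by blast
  define B' where "B' = enc ` H"
  define \<delta>' where "\<delta>' x = fst (inv_into H enc x)" for x
  define c where "c x = snd (inv_into H enc x)" for x
  have dec: "\<delta>' (enc (j, u)) = j" "c (enc (j, u)) = u" if "(j, u) \<in> H" for j u
    using inv_into_f_f[OF injH that] by (auto simp: \<delta>'_def c_def)
  have cZ: "c x \<in> Z" "c x \<in> free_grading A G B \<delta> (\<delta>' x)" if x: "x \<in> B'" for x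
  proof -
    obtain j u where ju: "(j, u) \<in> H" "x = enc (j, u)" using x unfolding B'_def by auto
    then show "c x \<in> Z" "c x \<in> free_grading A G B \<delta> (\<delta>' x)"
      using dec[OF ju(1)] by (auto simp: H_def)
  qed
  have cc: "c x \<in> carrier (FM B)" if "x \<in> B'" for x using cZ(1)[OF that] Zc by blast
  define \<phi> where "\<phi> v = (\<Oplus>\<^bsub>FM B\<^esub>x\<in>{x. v x \<noteq> \<zero>}. v x \<odot>\<^bsub>FM B\<^esub> c x)" for v
  have supp: "{x. v x \<noteq> \<zero>} \<subseteq> B'" "finite {x. v x \<noteq> \<zero>}" if "v \<in> carrier (FM B')" for v
    using that by (auto simp: free_module_carrier)
  have term_closed: "v x \<odot>\<^bsub>FM B\<^esub> c x \<in> carrier (FM B)" if "v \<in> carrier (FM B')" "x \<in> B'" for v x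
    by (rule M.smult_closed[OF free_module_coord[OF that(1)] cc[OF that(2)]])
  have phi_sup: "\<phi> v = (\<Oplus>\<^bsub>FM B\<^esub>x\<in>S. v x \<odot>\<^bsub>FM B\<^esub> c x)"
    if v: "v \<in> carrier (FM B')" and S: "finite S" "{x. v x \<noteq> \<zero>} \<subseteq> S" "S \<subseteq> B'" for v S
    unfolding \<phi>_def
    using S v term_closed cc by (intro M.add.finprod_mono_neutral_cong_left) auto
  have add: "\<phi> (u \<oplus>\<^bsub>FM B'\<^esub> v) = \<phi> u \<oplus>\<^bsub>FM B\<^esub> \<phi> v"
    if u: "u \<in> carrier (FM B')" and v: "v \<in> carrier (FM B')" for u v
  proof -
    define S where "S = {x. u x \<noteq> \<zero>} \<union> {x. v x \<noteq> \<zero>}"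
    have S: "finite S" "S \<subseteq> B'" using supp u v by (auto simp: S_def)
    interpret M': module A "FM B'" by (rule free_module_module)
    have uv: "u \<oplus>\<^bsub>FM B'\<^esub> v \<in> carrier (FM B')" using u v by simp
    have "\<phi> (u \<oplus>\<^bsub>FM B'\<^esub> v) = (\<Oplus>\<^bsub>FM B\<^esub>x\<in>S. (u \<oplus>\<^bsub>FM B'\<^esub> v) x \<odot>\<^bsub>FM B\<^esub> c x)"
      using S by (intro phi_sup[OF uv]) (auto simp: S_def free_module_simps)
    also have "\<dots> = (\<Oplus>\<^bsub>FM B\<^esub>x\<in>S. u x \<odot>\<^bsub>FM B\<^esub> c x \<oplus>\<^bsub>FM B\<^esub> v x \<odot>\<^bsub>FM B\<^esub> c x)"
      using S cc free_module_coord[OF u] free_module_coord[OF v] term_closed u v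
      by (intro M.finsum_cong') (auto simp: free_module_simps(2)[of A B'] M.smult_l_distr subset_iff)
    also have "\<dots> = (\<Oplus>\<^bsub>FM B\<^esub>x\<in>S. u x \<odot>\<^bsub>FM B\<^esub> c x) \<oplus>\<^bsub>FM B\<^esub> (\<Oplus>\<^bsub>FM B\<^esub>x\<in>S. v x \<odot>\<^bsub>FM B\<^esub> c x)"
      using S term_closed u v by (intro M.finsum_addf) auto
    also have "\<dots> = \<phi> u \<oplus>\<^bsub>FM B\<^esub> \<phi> v"
      using S phi_sup[OF u, of S] phi_sup[OF v, of S] by (simp add: S_def)
    finally show ?thesis .
  qed
  have smult: "\<phi> (a \<odot>\<^bsub>FM B'\<^esub> u) = a \<odot>\<^bsub>FM B\<^esub> \<phi> u"
    if a: "a \<in> carrier A" and u: "u \<in> carrier (FM B')" for a u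
  proof -
    define S where "S = {x. u x \<noteq> \<zero>}"
    have S: "finite S" "S \<subseteq> B'" using supp[OF u] by (auto simp: S_def)
    interpret M': module A "FM B'" by (rule free_module_module)
    have au: "a \<odot>\<^bsub>FM B'\<^esub> u \<in> carrier (FM B')" using a u by simp
    have "\<phi> (a \<odot>\<^bsub>FM B'\<^esub> u) = (\<Oplus>\<^bsub>FM B\<^esub>x\<in>S. (a \<odot>\<^bsub>FM B'\<^esub> u) x \<odot>\<^bsub>FM B\<^esub> c x)"
      using S a by (intro phi_sup[OF au]) (auto simp: S_def free_module_simps)
    also have "\<dots> = (\<Oplus>\<^bsub>FM B\<^esub>x\<in>S. a \<odot>\<^bsub>FM B\<^esub> (u x \<odot>\<^bsub>FM B\<^esub> c x))"
      using S cc free_module_coord[OF u] term_closed u a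
      by (intro M.finsum_cong') (auto simp: free_module_simps(3)[of A B'] M.smult_assoc1 subset_iff)
    also have "\<dots> = a \<odot>\<^bsub>FM B\<^esub> \<phi> u"
      using S term_closed u a unfolding \<phi>_def S_def[symmetric]
      by (intro M.finsum_smult_ldistr[symmetric]) auto
    finally show ?thesis .
  qed
  have inZ: "\<phi> v \<in> Z" if v: "v \<in> carrier (FM B')" for v
    unfolding \<phi>_def
    using Z0 Zadd Zc supp[OF v] cZ(1) Zsm free_module_coord[OF v]
    by (intro M.finsum_in) auto
  have graded: "\<phi> v \<in> free_grading A G B \<delta> j" if v: "v \<in> free_grading A G B' \<delta>' j" for v j
    unfolding \<phi>_def
  proof (rule M.finsum_in)
    fix x assume x: "x \<in> {x. v x \<noteq> \<zero>}"
    have vc: "v \<in> carrier (FM B')" using v by (rule free_grading_closed)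
    have xB: "x \<in> B'" using supp(1)[OF vc] x by auto
    then have vx: "\<delta>' x \<le> j" "v x \<in> G (j - \<delta>' x)"
      using v x by (auto simp: free_grading_def split: if_splits)
    show "v x \<odot>\<^bsub>FM B\<^esub> c x \<in> free_grading A G B \<delta> j"
      using free_grading_smult[OF vx(2) cZ(2)[OF xB]] vx(1) by simp
  qed (auto simp: free_grading_zero free_grading_add free_grading_closed)
  have hom: "\<phi> \<in> graded_hom A (FM B') (free_grading A G B' \<delta>') (FM B) (free_grading A G B \<delta>)"
    unfolding graded_hom_def using add smult inZ Zc graded by auto
  have hit: "u \<in> \<phi> ` carrier (FM B')" if u: "(j, u) \<in> H" for j u
  proof -
    let ?x = "enc (j, u)"
    let ?e = "\<lambda>y. if y = ?x then \<one> else \<zero>"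
    have x: "?x \<in> B'" using u by (auto simp: B'_def)
    have e: "?e \<in> carrier (FM B')" by (rule free_module_single[OF x one_closed])
    have uc: "u \<in> carrier (FM B)" using u Zc by (auto simp: H_def)
    have "\<phi> ?e = (\<Oplus>\<^bsub>FM B\<^esub>y\<in>{?x}. ?e y \<odot>\<^bsub>FM B\<^esub> c y)"
      using x by (intro phi_sup[OF e]) auto
    also have "\<dots> = u"
      using uc by (simp add: dec[OF u])
    finally show ?thesis using imageI[OF e, of \<phi>] by (simp only:)
  qed
  have "Z \<subseteq> \<phi> ` carrier (FM B')"
  proof
    fix z assume z: "z \<in> Z"
    then have zc: "z \<in> carrier (FM B)" using Zc by blast
    obtain d where d: "z = (\<Oplus>\<^bsub>FM B\<^esub>j\<in>{..d}. free_pr B \<delta> j z)"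
      using free_decomposition[OF zc] by blast
    interpret M': module A "FM B'" by (rule free_module_module)
    have "(\<Oplus>\<^bsub>FM B\<^esub>j\<in>{..d}. free_pr B \<delta> j z) \<in> \<phi> ` carrier (FM B')"
    proof (rule M.finsum_in)
      show "\<zero>\<^bsub>FM B\<^esub> \<in> \<phi> ` carrier (FM B')"
        using free_hom_zero[OF hom] M'.zero_closed
        by (intro image_eqI[of _ _ "\<zero>\<^bsub>FM B'\<^esub>"]) (simp_all add: free_module_simps(1))
      show "x \<oplus>\<^bsub>FM B\<^esub> y \<in> \<phi> ` carrier (FM B')"
        if xy: "x \<in> \<phi> ` carrier (FM B')" "y \<in> \<phi> ` carrier (FM B')" for x y
      proof -
        obtain u v where uv: "u \<in> carrier (FM B')" "v \<in> carrier (FM B')" "x = \<phi> u" "y = \<phi> v"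
          using xy by blast
        then show ?thesis
          using add[OF uv(1,2)] by (intro image_eqI[of _ _ "u \<oplus>\<^bsub>FM B'\<^esub> v"]) auto
      qed
      show "\<phi> ` carrier (FM B') \<subseteq> carrier (FM B)" using inZ Zc by blast
      show "free_pr B \<delta> j z \<in> \<phi> ` carrier (FM B')" for j
        by (rule hit[of j]) (simp add: H_def Zpr[OF z] free_pr_in[OF zc])
    qed
    then show "z \<in> \<phi> ` carrier (FM B')" by (simp flip: d)
  qed
  then have "\<phi> ` carrier (FM B') = Z" using inZ by blast
  then show ?thesis
    using hom by (intro exI[of _ B'] exI[of _ \<delta>'] bexI[of _ \<phi>])
qed

lemma graded_submodule_kernel:
  assumes f: "f \<in> graded_hom A (FM B') (free_grading A G B' \<delta>') (FM B) (free_grading A G B \<delta>)"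
  shows "graded_submodule B' \<delta>' {u \<in> carrier (FM B'). f u = \<zero>\<^bsub>FM B\<^esub>}"
proof -
  interpret M: module A "FM B" by (rule free_module_module)
  interpret M': module A "FM B'" by (rule free_module_module)
  have "f (free_pr B' \<delta>' j u) = \<zero>\<^bsub>FM B\<^esub>"
    if "u \<in> carrier (FM B')" "f u = \<zero>\<^bsub>FM B\<^esub>" for u j
    using that by (simp add: free_hom_pr[OF f] free_module_simps(1) free_pr_zero)
  then show ?thesis
    using free_hom_zero[OF f] unfolding graded_submodule_def
    by (auto simp: graded_homD(2,3)[OF f] free_pr_closed)
      (simp add: free_module_simps(1))
qed

lemma residue_module_simps:
  "carrier (residue_module A G) = carrier (A Quot irrelevant_ideal A G)"
  "\<zero>\<^bsub>residue_module A G\<^esub> = \<zero>\<^bsub>A Quot irrelevant_ideal A G\<^esub>"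
  "x \<oplus>\<^bsub>residue_module A G\<^esub> y = x \<oplus>\<^bsub>A Quot irrelevant_ideal A G\<^esub> y"
  "a \<odot>\<^bsub>residue_module A G\<^esub> x =
     (irrelevant_ideal A G +> a) \<otimes>\<^bsub>A Quot irrelevant_ideal A G\<^esub> x"
  by (simp_all add: residue_module_def Let_def)

text \<open>
  The resolution starts with \<open>A \<rightarrow> A / A_+\<close> on one generator of degree 0 and continues by covering
  each successive kernel, which is again a graded submodule. The state of the recursion is a free
  module together with the submodule that is covered next.
\<close>

lemma residue_resolution_exists:
  assumes "infinite (UNIV :: 'b set)" "inj (\<iota> :: 'a \<Rightarrow> 'b)" "inj (\<nu> :: nat \<Rightarrow> 'b)"
  shows "\<exists>F :: ('a, 'b, 'a set) free_complex.
    graded_free_resolution A G (residue_module A G) (residue_grading A G) F"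
proof -
  obtain enc :: "nat \<times> ('b \<Rightarrow> 'a) \<Rightarrow> 'b" where enc: "inj_on enc {(j, u). finite {x. u x \<noteq> \<zero>}}"
    using finite_support_injection[OF assms, of \<zero>] by blast
  let ?I = "irrelevant_ideal A G"
  interpret I: ideal ?I A by (rule irrelevant_ideal_ideal)
  have zeroQ: "\<zero>\<^bsub>A Quot ?I\<^esub> = ?I" by (simp add: FactRing_def)
  have carQ: "carrier (A Quot ?I) = (\<lambda>a. ?I +> a) ` carrier A"
    by (auto simp: FactRing_def A_RCOSETS_def')
  interpret h: ring_hom_ring A "A Quot ?I" "(+>) ?I" by (rule I.rcos_ring_hom_ring)
  have ker: "?I +> a = ?I \<longleftrightarrow> a \<in> ?I" if "a \<in> carrier A" for a
    using that I.a_rcos_const I.a_rcos_self by blast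
  define x0 :: 'b where "x0 = \<nu> 0"
  define B0 where "B0 = {x0}"
  define \<delta>0 :: "'b \<Rightarrow> nat" where "\<delta>0 = (\<lambda>_. 0)"
  define aug0 where "aug0 u = ?I +> u x0" for u :: "'b \<Rightarrow> 'a"
  define Z0 where "Z0 = {u \<in> carrier (FM B0). aug0 u = ?I}"
  have aug0: "aug0 \<in> graded_hom A (FM B0) (free_grading A G B0 \<delta>0) (residue_module A G) (residue_grading A G)"
  proof -
    have "aug0 u \<in> residue_grading A G j" if u: "u \<in> free_grading A G B0 \<delta>0 j" for u j
    proof (cases "j = 0")
      case True
      then show ?thesis
        using free_module_coord[OF free_grading_closed[OF u], of x0]
        by (simp add: aug0_def residue_grading_def residue_module_simps)
    next
      case False
      have "u x0 \<in> G j" using u by (auto simp: free_grading_def B0_def \<delta>0_def)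
      then have "u x0 \<in> ?I"
        using False pr_other[of "u x0" j 0] G_carrier[of "u x0" j]
        unfolding irrelevant_ideal_eq by simp
      then show ?thesis
        using False ker G_carrier[OF \<open>u x0 \<in> G j\<close>]
        by (simp add: aug0_def residue_grading_def residue_module_simps zeroQ)
    qed
    moreover have "aug0 u \<in> carrier (A Quot ?I)" if "u \<in> carrier (FM B0)" for u
      using free_module_coord[OF that, of x0] by (simp add: aug0_def)
    ultimately show ?thesis
      unfolding graded_hom_def
      by (auto simp: residue_module_simps aug0_def free_module_simps free_module_coord[of _ B0])
  qed
  have Z0: "graded_submodule B0 \<delta>0 Z0"
  proof -
    interpret M: module A "FM B0" by (rule free_module_module)
    have Z0': "Z0 = {u \<in> carrier (FM B0). u x0 \<in> ?I}"
      unfolding Z0_def aug0_def by (rule Collect_cong) (metis ker free_module_coord)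
    have "free_pr B0 \<delta>0 j u x0 \<in> ?I" if u: "u \<in> carrier (FM B0)" "u x0 \<in> ?I" for u j
    proof -
      have "pr 0 (pr j (u x0)) = \<zero>"
      proof (cases "j = 0")
        case True
        then show ?thesis using u(2) pr_same[OF pr_in] unfolding irrelevant_ideal_eq by simp
      next
        case False
        then show ?thesis
          using free_module_coord[OF u(1), of x0] pr_other[OF pr_in, of "u x0" 0 j] by simp
      qed
      then show ?thesis
        using free_module_coord[OF u(1), of x0]
        unfolding irrelevant_ideal_eq by (simp add: free_pr_def B0_def \<delta>0_def)
    qed
    then show ?thesis
      unfolding graded_submodule_def Z0'
      using I.I_l_closed I.a_closed I.zero_closed M.zero_closed M.a_closed M.smult_closed free_pr_closed
      by (auto simp: free_module_simps)
  qed
  define ok where "ok n s \<longleftrightarrow> (case s of (B, \<delta>, Z) \<Rightarrow> graded_submodule B \<delta> Z) \<and>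
      (n = 0 \<longrightarrow> s = (B0, \<delta>0, Z0))" for n :: nat and s :: "'b set \<times> ('b \<Rightarrow> nat) \<times> ('b \<Rightarrow> 'a) set"
  define cov where "cov \<phi> s s' \<longleftrightarrow> (case s of (B, \<delta>, Z) \<Rightarrow> case s' of (B', \<delta>', Z') \<Rightarrow>
      \<phi> \<in> graded_hom A (FM B') (free_grading A G B' \<delta>') (FM B) (free_grading A G B \<delta>) \<and>
      \<phi> ` carrier (FM B') = Z \<and> Z' = {u \<in> carrier (FM B'). \<phi> u = \<zero>\<^bsub>FM B\<^esub>})"
    for \<phi> and s s' :: "'b set \<times> ('b \<Rightarrow> nat) \<times> ('b \<Rightarrow> 'a) set"
  have "\<exists>f. \<forall>n. ok n (f n) \<and> (\<exists>\<phi>. cov \<phi> (f n) (f (Suc n)))"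
  proof (rule dependent_nat_choice[where P = ok and Q = "\<lambda>n s s'. \<exists>\<phi>. cov \<phi> s s'"])
    show "\<exists>s. ok 0 s" using Z0 by (auto simp: ok_def)
    fix s n assume "ok n s"
    then obtain B \<delta> Z where s: "s = (B, \<delta>, Z)" and Z: "graded_submodule B \<delta> Z"
      by (auto simp: ok_def split: prod.splits)
    obtain B' :: "'b set" and \<delta>' \<phi> where \<phi>: "\<phi> \<in> graded_hom A (FM B') (free_grading A G B' \<delta>') (FM B) (free_grading A G B \<delta>)"
        "\<phi> ` carrier (FM B') = Z"
      using graded_cover[OF enc Z] by blast
    let ?s' = "(B', \<delta>', {u \<in> carrier (FM B'). \<phi> u = \<zero>\<^bsub>FM B\<^esub>})"
    have "ok (Suc n) ?s'" using graded_submodule_kernel[OF \<phi>(1)] by (simp add: ok_def)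
    moreover have "cov \<phi> s ?s'" using \<phi> by (simp add: cov_def s)
    ultimately show "\<exists>s'. ok (Suc n) s' \<and> (\<exists>\<phi>. cov \<phi> s s')" by blast
  qed
  then obtain f where f: "\<And>n. ok n (f n)" "\<And>n. \<exists>\<phi>. cov \<phi> (f n) (f (Suc n))" by blast
  then obtain \<Phi> where \<Phi>: "\<And>n. cov (\<Phi> n) (f n) (f (Suc n))" by metis
  define F where "F = \<lparr>gens = \<lambda>n. fst (f n), gdeg = \<lambda>n. fst (snd (f n)), bd = \<Phi>, aug = aug0\<rparr>"
  have f0: "f 0 = (B0, \<delta>0, Z0)" using f(1)[of 0] by (simp add: ok_def)
  have cov: "\<Phi> n \<in> graded_hom A (FM (fst (f (Suc n)))) (free_grading A G (fst (f (Suc n))) (fst (snd (f (Suc n)))))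
        (FM (fst (f n))) (free_grading A G (fst (f n)) (fst (snd (f n))))"
      "\<Phi> n ` carrier (FM (fst (f (Suc n)))) = snd (snd (f n))"
      "snd (snd (f (Suc n))) = {u \<in> carrier (FM (fst (f (Suc n)))). \<Phi> n u = \<zero>\<^bsub>FM (fst (f n))\<^esub>}" for n
    using \<Phi>[of n] by (auto simp: cov_def split: prod.splits)
  have "aug0 ` carrier (FM B0) = carrier (residue_module A G)"
  proof
    show "aug0 ` carrier (FM B0) \<subseteq> carrier (residue_module A G)"
      using graded_homD(1)[OF aug0] by blast
    show "carrier (residue_module A G) \<subseteq> aug0 ` carrier (FM B0)"
    proof
      fix c assume "c \<in> carrier (residue_module A G)"
      then obtain a where a: "a \<in> carrier A" "c = ?I +> a"
        unfolding residue_module_simps carQ by blast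
      have "(\<lambda>y. if y = x0 then a else \<zero>) \<in> carrier (FM B0)"
        using a(1) by (intro free_module_single) (simp_all add: B0_def)
      moreover have "aug0 (\<lambda>y. if y = x0 then a else \<zero>) = c"
        using a(2) by (simp add: aug0_def)
      ultimately show "c \<in> aug0 ` carrier (FM B0)" by blast
    qed
  qed
  then have "graded_free_resolution A G (residue_module A G) (residue_grading A G) F"
    unfolding graded_free_resolution_def F_def
    using cov aug0 by (auto simp: f0 Z0_def residue_module_simps zeroQ simp flip: cov(3))
  then show ?thesis by blast
qed

end

section \<open>Koszulness from linear quotients\<close>

context graded_cring
begin

definition colon_elem :: "'a set \<Rightarrow> 'a \<Rightarrow> 'a set" where
  "colon_elem J x = {a \<in> carrier A. a \<otimes> x \<in> J}"

text \<open>
  The ideals reached from zero by adjoining one linear form at a time, where all colon ideals met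
  on the way lie in \<open>\<Q>\<close>. If \<open>\<Q>\<close> itself consists of reached ideals and \<open>A_+\<close> is reached, then the
  reached ideals form a Koszul filtration. In contrast to a Koszul filtration, the inductive definition comes with a
  well-founded order on the ideals along which homology can be computed.
\<close>

inductive_set linear_quotients :: "'a set set \<Rightarrow> 'a set set" for \<Q> where
  zero: "{\<zero>} \<in> linear_quotients \<Q>"
| step: "\<lbrakk>J \<in> linear_quotients \<Q>; x \<in> G 1; x \<notin> J; colon_elem J x \<in> \<Q>\<rbrakk>
    \<Longrightarrow> J <+>\<^bsub>A\<^esub> PIdl x \<in> linear_quotients \<Q>"

lemma add_PIdl_iff: "c \<in> J <+>\<^bsub>A\<^esub> PIdl x \<longleftrightarrow> (\<exists>b\<in>J. \<exists>a\<in>carrier A. c = b \<oplus> a \<otimes> x)"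
  unfolding set_add_def' cgenideal_def by auto

lemma add_PIdlI: "\<lbrakk>b \<in> J; a \<in> carrier A\<rbrakk> \<Longrightarrow> b \<oplus> a \<otimes> x \<in> J <+>\<^bsub>A\<^esub> PIdl x"
  unfolding add_PIdl_iff by blast

lemma add_PIdl_upper:
  assumes J: "ideal J A" and x: "x \<in> carrier A"
  shows "J \<subseteq> J <+>\<^bsub>A\<^esub> PIdl x" "x \<in> J <+>\<^bsub>A\<^esub> PIdl x"
proof -
  interpret J: ideal J A by (rule J)
  have "b \<in> J <+>\<^bsub>A\<^esub> PIdl x" if "b \<in> J" for b
    using add_PIdlI[OF that zero_closed, of x] J.a_Hcarr[OF that] x by simp
  then show "J \<subseteq> J <+>\<^bsub>A\<^esub> PIdl x" by blast
  show "x \<in> J <+>\<^bsub>A\<^esub> PIdl x"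
    using add_PIdlI[OF J.zero_closed one_closed, of x] x by simp
qed

lemma linear_quotients_ideal: "I \<in> linear_quotients \<Q> \<Longrightarrow> ideal I A"
proof (induction rule: linear_quotients.induct)
  case zero
  show ?case by (rule zeroideal)
next
  case (step J x)
  then show ?case
    by (intro add_ideals cgenideal_ideal G_carrier[of x 1])
qed

lemma linear_quotients_pr: "\<lbrakk>I \<in> linear_quotients \<Q>; c \<in> I\<rbrakk> \<Longrightarrow> pr m c \<in> I"
proof (induction arbitrary: m c rule: linear_quotients.induct)
  case (step J x)
  have x: "x \<in> carrier A" using step by (intro G_carrier[of x 1])
  interpret J: ideal J A using step by (intro linear_quotients_ideal)
  obtain b a where ba: "b \<in> J" "a \<in> carrier A" "c = b \<oplus> a \<otimes> x"
    using step.prems add_PIdl_iff by blast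
  have "pr m c = pr m b \<oplus> pr m (x \<otimes> a)"
    using ba J.a_Hcarr[OF ba(1)] x by (simp add: pr_add m_comm)
  also have "\<dots> = pr m b \<oplus> (if 1 \<le> m then pr (m - 1) a else \<zero>) \<otimes> x"
    using pr_mult[OF \<open>x \<in> G 1\<close> ba(2), of m] ba x by (simp add: m_comm)
  finally have "pr m c = pr m b \<oplus> (if 1 \<le> m then pr (m - 1) a else \<zero>) \<otimes> x" .
  moreover have "(if 1 \<le> m then pr (m - 1) a else \<zero>) \<in> carrier A" using ba by simp
  ultimately show ?case
    using add_PIdlI[OF step.IH[OF ba(1)]] by simp
qed simp

lemma linear_quotients_generated:
  "I \<in> linear_quotients \<Q> \<Longrightarrow> \<exists>E\<subseteq>G 1. I = Idl E"
proof (induction rule: linear_quotients.induct)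
  case zero
  have "Idl {} \<subseteq> {\<zero>}" by (rule genideal_minimal[OF zeroideal]) simp
  moreover have "\<zero> \<in> Idl {}"
    using additive_subgroup.zero_closed[OF ideal.axioms(1)[OF genideal_ideal]] by simp
  ultimately show ?case by (intro exI[of _ "{}"]) auto
next
  case (step J x)
  then obtain E where E: "E \<subseteq> G 1" "J = Idl E" by blast
  have x: "x \<in> carrier A" using step by (intro G_carrier[of x 1])
  have Ec: "insert x E \<subseteq> carrier A" using E x G_carrier[of _ 1] by auto
  have J: "ideal J A" using step(1) by (rule linear_quotients_ideal)
  interpret I: ideal "Idl (insert x E)" A by (rule genideal_ideal[OF Ec])
  have "J <+>\<^bsub>A\<^esub> PIdl x = Idl (insert x E)"
  proof
    have "J \<subseteq> Idl (insert x E)"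
      unfolding E(2) using genideal_self[OF Ec] by (intro genideal_minimal I.is_ideal) auto
    moreover have "x \<in> Idl (insert x E)" using genideal_self[OF Ec] by auto
    ultimately show "J <+>\<^bsub>A\<^esub> PIdl x \<subseteq> Idl (insert x E)"
      unfolding subset_iff add_PIdl_iff by (auto intro!: I.I_l_closed I.a_closed)
    have "E \<subseteq> J" unfolding E(2) using genideal_self Ec by auto
    then show "Idl (insert x E) \<subseteq> J <+>\<^bsub>A\<^esub> PIdl x"
      using add_PIdl_upper[OF J x]
      by (intro genideal_minimal add_ideals J cgenideal_ideal x) auto
  qed
  then show ?case
    using E step(2) by (intro exI[of _ "insert x E"]) auto
qed

lemma koszul_filtration_linear_quotients:
  assumes Q: "\<Q> \<subseteq> linear_quotients \<Q>" and irr: "irrelevant_ideal A G \<in> linear_quotients \<Q>"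
  shows "koszul_filtration A G (linear_quotients \<Q>)"
proof -
  have "\<exists>J\<in>linear_quotients \<Q>. J \<subset> I \<and> (\<exists>x\<in>I. I = J <+>\<^bsub>A\<^esub> PIdl x) \<and>
      colon_ideal A J I \<in> linear_quotients \<Q>"
    if "I \<in> linear_quotients \<Q>" "I \<noteq> {\<zero>}" for I
    using that(1)
  proof cases
    case (step J x)
    have x: "x \<in> carrier A" using step by (intro G_carrier[of x 1])
    interpret J: ideal J A using step by (intro linear_quotients_ideal)
    note up = add_PIdl_upper[OF J.is_ideal x]
    have "colon_ideal A J I = colon_elem J x"
    proof
      show "colon_ideal A J I \<subseteq> colon_elem J x"
        using up(2) step by (auto simp: colon_ideal_def colon_elem_def)
      show "colon_elem J x \<subseteq> colon_ideal A J I"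
      proof
        fix a assume a: "a \<in> colon_elem J x"
        then have a': "a \<in> carrier A" "a \<otimes> x \<in> J" by (auto simp: colon_elem_def)
        have "a \<otimes> c \<in> J" if "c \<in> I" for c
        proof -
          have "c \<in> J <+>\<^bsub>A\<^esub> PIdl x" using that step(1) by simp
          then obtain b d where bd: "b \<in> J" "d \<in> carrier A" "c = b \<oplus> d \<otimes> x"
            unfolding add_PIdl_iff by blast
          have "a \<otimes> c = a \<otimes> b \<oplus> d \<otimes> (a \<otimes> x)"
            using bd a' x J.a_Hcarr[OF bd(1)] by (simp add: r_distr m_lcomm)
          then show ?thesis
            using J.a_closed[OF J.I_l_closed[OF bd(1) a'(1)] J.I_l_closed[OF a'(2) bd(2)]]
            by (simp only:)
        qed
        then show "a \<in> colon_ideal A J I" using a' by (simp add: colon_ideal_def)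
      qed
    qed
    then show ?thesis
      using step up Q by (intro bexI[of _ J]) auto
  qed (use that in simp)
  then show ?thesis
    unfolding koszul_filtration_def
    using linear_quotients_ideal linear_quotients_generated irr linear_quotients.zero by blast
qed

lemma G_neg: "a \<in> G m \<Longrightarrow> \<ominus> a \<in> G m"
proof -
  assume a: "a \<in> G m"
  then have ac: "a \<in> carrier A" by (rule G_carrier)
  have "pr m a \<oplus> pr m (\<ominus> a) = \<zero>"
    using pr_add[OF ac, of "\<ominus> a" m] ac by (simp add: r_neg)
  then have "pr m (\<ominus> a) = \<ominus> a"
    using ac pr_same[OF a] minus_equality[of "pr m (\<ominus> a)" a] by (simp add: a_comm)
  then show ?thesis using pr_in[of "\<ominus> a" m] ac by simp
qed

lemma free_grading_neg:
  assumes "u \<in> free_grading A G B \<delta> j"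
  shows "(\<ominus> \<one>) \<odot>\<^bsub>FM B\<^esub> u \<in> free_grading A G B \<delta> j"
proof -
  have u: "u \<in> carrier (FM B)" using assms by (rule free_grading_closed)
  then have "(\<ominus> \<one>) \<odot>\<^bsub>FM B\<^esub> u \<in> carrier (FM B)"
    using module.smult_closed[OF free_module_module] by blast
  moreover have "\<ominus> \<one> \<otimes> u x = \<ominus> u x" for x
    using free_module_coord[OF u] by (simp add: l_minus)
  ultimately show ?thesis
    using assms by (auto simp: free_grading_def free_module_simps intro!: G_neg split: if_splits)
qed

lemma free_pr_smult:
  assumes x: "x \<in> G 1" and a: "a \<in> carrier (FM B)"
  shows "free_pr B \<delta> (Suc j) (x \<odot>\<^bsub>FM B\<^esub> a) = x \<odot>\<^bsub>FM B\<^esub> free_pr B \<delta> j a"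
    and "free_pr B \<delta> 0 (x \<odot>\<^bsub>FM B\<^esub> a) = (\<lambda>_. \<zero>)"
proof -
  have xc: "x \<in> carrier A" using x by (rule G_carrier)
  have ac: "a y \<in> carrier A" for y using a by (rule free_module_coord)
  have "pr n (x \<otimes> a y) = (if 1 \<le> n then x \<otimes> pr (n - 1) (a y) else \<zero>)" for n y
    using pr_mult[OF x ac] .
  then show "free_pr B \<delta> (Suc j) (x \<odot>\<^bsub>FM B\<^esub> a) = x \<odot>\<^bsub>FM B\<^esub> free_pr B \<delta> j a"
    and "free_pr B \<delta> 0 (x \<odot>\<^bsub>FM B\<^esub> a) = (\<lambda>_. \<zero>)"
    using xc ac by (auto simp: free_pr_def free_module_simps fun_eq_iff Suc_diff_le)
qed

text \<open>
  For a resolution \<open>F\<close> of the residue field, the homology of \<open>F/IF\<close> is \<open>Tor\<^sup>A(A/I, k)\<close>, and the lemma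
  says that its component of homological degree \<open>i\<close> and internal degree \<open>j\<close> vanishes for \<open>i \<noteq> j\<close>. If
  \<open>I = J + (x)\<close> then \<open>0 \<rightarrow> F/(J:x)F \<rightarrow> F/JF \<rightarrow> F/IF \<rightarrow> 0\<close>, with multiplication by \<open>x\<close> as the first map, is
  an exact sequence of complexes. Since \<open>x\<close> has degree 1, the homology of \<open>F/IF\<close> in position \<open>(i, j)\<close>
  lies between that of \<open>F/JF\<close> in position \<open>(i, j)\<close> and that of \<open>F/(J:x)F\<close> in position \<open>(i-1, j-1)\<close>. So
  an induction on \<open>i\<close>, and for fixed \<open>i\<close> along the construction of \<open>I\<close>, reduces the claim to \<open>I = 0\<close>,
  where it says that \<open>F\<close> is exact and that \<open>k\<close> is concentrated in degree 0. The proof below is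
  this argument on elements.
\<close>

lemma linear_quotients_acyclic:
  assumes F: "graded_free_resolution A G (residue_module A G) (residue_grading A G) F"
    and Q: "\<Q> \<subseteq> linear_quotients \<Q>"
  shows "\<lbrakk>I \<in> linear_quotients \<Q>; i \<noteq> j; z \<in> cplx_grading A G F i j;
      \<And>l x. i = Suc l \<Longrightarrow> bd F l z x \<in> I\<rbrakk>
    \<Longrightarrow> \<exists>y\<in>cplx_grading A G F (Suc i) j. \<exists>f\<in>cplx_grading A G F i j.
        (\<forall>x. f x \<in> I) \<and> z = bd F i y \<oplus>\<^bsub>cplx_module A F i\<^esub> f"
proof (induction i arbitrary: I j z rule: less_induct)
  case (less i)
  have bdhom: "bd F l \<in> graded_hom A (cplx_module A F (Suc l)) (cplx_grading A G F (Suc l))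
                                (cplx_module A F l) (cplx_grading A G F l)" for l
    using F unfolding graded_free_resolution_def by blast
  have kernel: "{u \<in> carrier (cplx_module A F (Suc l)). bd F l u = \<zero>\<^bsub>cplx_module A F l\<^esub>} =
       bd F (Suc l) ` carrier (cplx_module A F (Suc (Suc l)))" for l
    using F unfolding graded_free_resolution_def by blast
  have M: "module A (cplx_module A F l)" for l by (rule free_module_module)
  \<comment> \<open>A homogeneous boundary is the boundary of a homogeneous element.\<close>
  have lift: "\<exists>y\<in>cplx_grading A G F (Suc i) j. z = bd F i y"
    if z: "z \<in> cplx_grading A G F i j" "z \<in> bd F i ` carrier (cplx_module A F (Suc i))" for z j
  proof -
    obtain y where y: "y \<in> carrier (cplx_module A F (Suc i))" "z = bd F i y" using z(2) by blast
    have "bd F i (free_pr (gens F (Suc i)) (gdeg F (Suc i)) j y) = free_pr (gens F i) (gdeg F i) j z"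
      using free_hom_pr[OF bdhom y(1)] y(2) by simp
    also have "\<dots> = z" using free_pr_homogeneous[OF z(1), of j] by simp
    finally show ?thesis using free_pr_in[OF y(1)] by metis
  qed
  show ?case
    using less.prems
  proof (induction I arbitrary: z rule: linear_quotients.induct)
    case zero
    have zc: "z \<in> carrier (cplx_module A F i)" using zero.prems free_grading_closed by blast
    have "z \<in> bd F i ` carrier (cplx_module A F (Suc i))"
    proof (cases i)
      case 0
      have "aug F z \<in> residue_grading A G j"
        using F zero.prems 0 unfolding graded_free_resolution_def by (blast dest: graded_homD(4))
      then have "aug F z = \<zero>\<^bsub>residue_module A G\<^esub>"
        using zero.prems 0 by (simp add: residue_grading_def)
      then show ?thesis
        using F zc 0 unfolding graded_free_resolution_def by blast
    next
      case (Suc l)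
      have "bd F l z = \<zero>\<^bsub>cplx_module A F l\<^esub>"
        using zero.prems(3) Suc by (auto simp: free_module_simps fun_eq_iff)
      then show ?thesis using kernel[of l] zc Suc by blast
    qed
    then obtain y where y: "y \<in> cplx_grading A G F (Suc i) j" "z = bd F i y"
      using lift zero.prems by blast
    moreover have "z = bd F i y \<oplus>\<^bsub>cplx_module A F i\<^esub> \<zero>\<^bsub>cplx_module A F i\<^esub>"
      using y(2) zc abelian_monoid.r_zero[OF abelian_group.axioms(1)[OF module.axioms(2)[OF M[of i]]]]
      by simp
    ultimately show ?case
      using free_grading_zero by (intro bexI[of _ y] bexI[of _ "\<zero>\<^bsub>cplx_module A F i\<^esub>"])
        (auto simp: free_module_simps(1))
  next
    case (step J x)
    let ?I = "J <+>\<^bsub>A\<^esub> PIdl x"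
    have x: "x \<in> carrier A" using step by (intro G_carrier[of x 1])
    have Ji: "ideal J A" using step(1) by (rule linear_quotients_ideal)
    interpret J: ideal J A by (rule Ji)
    have Ii: "ideal ?I A" using Ji x by (intro add_ideals cgenideal_ideal)
    interpret I: ideal ?I A by (rule Ii)
    note up = add_PIdl_upper[OF Ji x]
    \<comment> \<open>It suffices to reduce to a cycle modulo \<open>J\<close>.\<close>
    have mod_J: ?case if "\<And>l y. i = Suc l \<Longrightarrow> bd F l z y \<in> J"
      using step.IH[OF less.prems(2) step.prems(2) that] up(1) by blast
    show ?case
    proof (cases i)
      case 0
      then show ?thesis using mod_J by simp
    next
      case (Suc l)
      interpret Ml: module A "cplx_module A F l" by (rule M)
      interpret Mi: module A "cplx_module A F i" by (rule M)
      let ?Fl = "cplx_module A F l" and ?Fi = "cplx_module A F i"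
      let ?pr = "free_pr (gens F l) (gdeg F l)"
      have bdl: "bd F l \<in> graded_hom A ?Fi (cplx_grading A G F i) ?Fl (cplx_grading A G F l)"
        using bdhom[of l] Suc by simp
      have zc: "z \<in> carrier ?Fi" using step.prems(2) by (rule free_grading_closed)
      define t where "t = bd F l z"
      have tg: "t \<in> cplx_grading A G F l j"
        unfolding t_def by (rule graded_homD(4)[OF bdl step.prems(2)])
      then have tc: "t \<in> carrier ?Fl" by (rule free_grading_closed)
      have "\<exists>b a. b \<in> J \<and> a \<in> carrier A \<and> t y = b \<oplus> a \<otimes> x \<and> (t y = \<zero> \<longrightarrow> b = \<zero> \<and> a = \<zero>)" for y
      proof (cases "t y = \<zero>")
        case True
        then show ?thesis using x J.zero_closed by (intro exI[of _ \<zero>]) simp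
      next
        case False
        have "t y \<in> ?I" using step.prems(3)[OF Suc] by (simp add: t_def)
        then show ?thesis using False unfolding add_PIdl_iff by blast
      qed
      then obtain b a where ba: "\<And>y. b y \<in> J" "\<And>y. a y \<in> carrier A" "\<And>y. t y = b y \<oplus> a y \<otimes> x"
          "\<And>y. t y = \<zero> \<Longrightarrow> b y = \<zero> \<and> a y = \<zero>"
        by metis
      have supp: "f \<in> carrier ?Fl" if "\<And>y. f y \<in> carrier A" "\<And>y. t y = \<zero> \<Longrightarrow> f y = \<zero>" for f
      proof -
        have "{y. f y \<noteq> \<zero>} \<subseteq> {y. t y \<noteq> \<zero>}" using that(2) by auto
        then have "finite {y. f y \<noteq> \<zero>}"
          using tc by (auto simp: free_module_carrier intro: finite_subset)
        then show ?thesis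
          using that tc unfolding free_module_carrier by simp
      qed
      have ac: "a \<in> carrier ?Fl"
        by (rule supp[OF ba(2)]) (simp add: ba(4))
      have bc: "b \<in> carrier ?Fl"
        by (rule supp[OF J.a_Hcarr[OF ba(1)]]) (simp add: ba(4))
      have "t = b \<oplus>\<^bsub>?Fl\<^esub> x \<odot>\<^bsub>?Fl\<^esub> a"
        using ba(2) x by (simp add: free_module_simps fun_eq_iff ba(3) m_comm)
      then have tpr: "t = ?pr j b \<oplus>\<^bsub>?Fl\<^esub> ?pr j (x \<odot>\<^bsub>?Fl\<^esub> a)"
        using free_pr_homogeneous[OF tg, of j] free_pr_add[OF bc Ml.smult_closed[OF x ac]] by simp
      define w where "w = ?pr j b"
      have wJ: "w y \<in> J" for y
        using linear_quotients_pr[OF step(1) ba(1)] J.zero_closed by (simp add: w_def free_pr_def)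
      have wc: "w \<in> carrier ?Fl" unfolding w_def using bc by (rule free_pr_closed)
      show ?thesis
      proof (cases j)
        case 0
        then have "t = w"
          using tpr free_pr_smult(2)[OF \<open>x \<in> G 1\<close> ac] wc
          by (simp add: w_def flip: free_module_simps(1)[of A "gens F l"])
        then have "bd F l z y \<in> J" for y using wJ by (simp add: t_def)
        then show ?thesis using Suc by (intro mod_J) simp
      next
        case j: (Suc j')
        define u where "u = ?pr j' a"
        have ug: "u \<in> cplx_grading A G F l j'" unfolding u_def using ac by (rule free_pr_in)
        then have uc: "u \<in> carrier ?Fl" by (rule free_grading_closed)
        have tu: "t = w \<oplus>\<^bsub>?Fl\<^esub> x \<odot>\<^bsub>?Fl\<^esub> u"
          using tpr free_pr_smult(1)[OF \<open>x \<in> G 1\<close> ac] by (simp add: w_def u_def j)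
        \<comment> \<open>The quotient \<open>u\<close> of \<open>d z\<close> by \<open>x\<close> is a cycle modulo \<open>(J : x)\<close>.\<close>
        have cyc: "bd F k u y \<in> colon_elem J x" if l: "l = Suc k" for k y
        proof -
          have bdk: "bd F k \<in> graded_hom A ?Fl (cplx_grading A G F l)
              (cplx_module A F k) (cplx_grading A G F k)"
            using bdhom[of k] l by simp
          have "t \<in> bd F (Suc k) ` carrier (cplx_module A F (Suc (Suc k)))"
            unfolding t_def using zc l Suc by blast
          then have "bd F k t = \<zero>\<^bsub>cplx_module A F k\<^esub>" using kernel[of k] by blast
          moreover have "bd F k t = bd F k w \<oplus>\<^bsub>cplx_module A F k\<^esub> x \<odot>\<^bsub>cplx_module A F k\<^esub> bd F k u"
            unfolding tu using wc uc x Ml.smult_closed[OF x uc]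
            by (simp add: graded_homD(2,3)[OF bdk])
          ultimately have eq: "bd F k w y \<oplus> x \<otimes> bd F k u y = \<zero>"
            by (simp add: free_module_simps fun_eq_iff)
          have c: "bd F k u y \<in> carrier A"
            using graded_homD(1)[OF bdk uc] by (rule free_module_coord)
          have wy: "bd F k w y \<in> J" using wJ by (intro free_hom_ideal[OF bdk Ji wc]) blast
          have "x \<otimes> bd F k u y = \<ominus> bd F k w y"
            using eq c x J.a_Hcarr[OF wy] minus_equality[of "x \<otimes> bd F k u y" "bd F k w y"]
            by (simp add: a_comm)
          then show ?thesis
            using wy c x J.a_inv_closed by (simp add: colon_elem_def m_comm)
        qed
        have "\<exists>v\<in>cplx_grading A G F (Suc l) j'. \<exists>e\<in>cplx_grading A G F l j'.
            (\<forall>y. e y \<in> colon_elem J x) \<and> u = bd F l v \<oplus>\<^bsub>?Fl\<^esub> e"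
          using less.prems(2) step(4) Q cyc Suc j by (intro less.IH ug) auto
        then obtain v e where v: "v \<in> cplx_grading A G F i j'" and e: "e \<in> cplx_grading A G F l j'"
            and eK: "\<And>y. e y \<in> colon_elem J x" and uve: "u = bd F l v \<oplus>\<^bsub>?Fl\<^esub> e"
          using Suc by auto
        have vc: "v \<in> carrier ?Fi" using v by (rule free_grading_closed)
        have ec: "e \<in> carrier ?Fl" using e by (rule free_grading_closed)
        \<comment> \<open>By induction \<open>u\<close> is a boundary modulo \<open>(J : x)\<close>; this boundary is removed from \<open>z\<close>.\<close>
        define z' where "z' = z \<oplus>\<^bsub>?Fi\<^esub> (\<ominus> x) \<odot>\<^bsub>?Fi\<^esub> v"
        have xv: "(\<ominus> x) \<odot>\<^bsub>?Fi\<^esub> v \<in> cplx_grading A G F i j"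
            "x \<odot>\<^bsub>?Fi\<^esub> v \<in> cplx_grading A G F i j"
          using free_grading_smult[OF G_neg[OF \<open>x \<in> G 1\<close>] v]
            free_grading_smult[OF \<open>x \<in> G 1\<close> v] j by simp_all
        have z': "z' \<in> cplx_grading A G F i j"
          unfolding z'_def by (rule free_grading_add[OF step.prems(2) xv(1)])
        have "bd F l z' y \<in> J" for y
        proof -
          let ?v = "bd F l v"
          have vy: "?v y \<in> carrier A"
            using graded_homD(1)[OF bdl vc] by (rule free_module_coord)
          have ey: "e y \<in> carrier A" "e y \<otimes> x \<in> J" using eK[of y] by (auto simp: colon_elem_def)
          have "bd F l z' = t \<oplus>\<^bsub>?Fl\<^esub> (\<ominus> x) \<odot>\<^bsub>?Fl\<^esub> ?v"
            unfolding z'_def t_def using zc vc x free_grading_closed[OF xv(1)]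
            by (simp add: graded_homD(2,3)[OF bdl])
          then have "bd F l z' y = (w y \<oplus> x \<otimes> (?v y \<oplus> e y)) \<oplus> (\<ominus> x) \<otimes> ?v y"
            by (simp add: tu uve free_module_simps)
          also have "\<dots> = w y \<oplus> e y \<otimes> x"
          proof -
            have wy: "w y \<in> carrier A" using wJ by (rule J.a_Hcarr)
            have "(w y \<oplus> x \<otimes> (?v y \<oplus> e y)) \<oplus> (\<ominus> x) \<otimes> ?v y =
                (w y \<oplus> x \<otimes> e y) \<oplus> (x \<otimes> ?v y \<oplus> \<ominus> (x \<otimes> ?v y))"
              using wy vy ey x by (simp add: r_distr l_minus a_ac)
            also have "\<dots> = w y \<oplus> e y \<otimes> x"
              using wy vy ey x by (simp add: r_neg m_comm)
            finally show ?thesis .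
          qed
          finally show ?thesis using wJ ey J.a_closed by simp
        qed
        then have z'J: "\<And>k y. i = Suc k \<Longrightarrow> bd F k z' y \<in> J" using Suc by simp
        from step.IH[OF less.prems(2) z' z'J] obtain y f where
          y: "y \<in> cplx_grading A G F (Suc i) j" and f: "f \<in> cplx_grading A G F i j"
          and fJ: "\<And>p. f p \<in> J" and zyf: "z' = bd F i y \<oplus>\<^bsub>?Fi\<^esub> f"
          by blast
        have fc: "f \<in> carrier ?Fi" using f by (rule free_grading_closed)
        have yc: "bd F i y \<in> carrier ?Fi"
          using graded_homD(1)[OF bdhom free_grading_closed[OF y]] .
        have "z = z' \<oplus>\<^bsub>?Fi\<^esub> x \<odot>\<^bsub>?Fi\<^esub> v"
          unfolding z'_def using zc vc x by (simp add: Mi.smult_l_minus Mi.a_assoc Mi.l_neg)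
        also have "\<dots> = bd F i y \<oplus>\<^bsub>?Fi\<^esub> (f \<oplus>\<^bsub>?Fi\<^esub> x \<odot>\<^bsub>?Fi\<^esub> v)"
          unfolding zyf using yc fc vc x by (simp add: Mi.a_assoc)
        finally have "z = bd F i y \<oplus>\<^bsub>?Fi\<^esub> (f \<oplus>\<^bsub>?Fi\<^esub> x \<odot>\<^bsub>?Fi\<^esub> v)" .
        moreover have "f \<oplus>\<^bsub>?Fi\<^esub> x \<odot>\<^bsub>?Fi\<^esub> v \<in> cplx_grading A G F i j"
          by (rule free_grading_add[OF f xv(2)])
        moreover have "(f \<oplus>\<^bsub>?Fi\<^esub> x \<odot>\<^bsub>?Fi\<^esub> v) p \<in> ?I" for p
        proof -
          have "f p \<in> ?I" using fJ up(1) by blast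
          moreover have "x \<otimes> v p \<in> ?I"
            by (rule I.I_r_closed[OF up(2) free_module_coord[OF vc]])
          ultimately show ?thesis by (simp add: free_module_simps I.a_closed)
        qed
        ultimately show ?thesis using y by blast
      qed
    qed
  qed
qed

text \<open>
  The boundaries form a subgroup, so once every cycle is a boundary, the only coset is the group of
  boundaries itself.
\<close>

lemma tensor_homology_trivial:
  assumes F: "graded_free_resolution A G (residue_module A G) (residue_grading A G) F"
    and cycles: "tensor_cycles A G F i j \<subseteq> tensor_boundaries A G F i j"
  shows "carrier (tensor_homology A G F i j) = {\<one>\<^bsub>tensor_homology A G F i j\<^esub>}"
proof -
  let ?Fi = "cplx_module A F i"
  let ?N = "tensor_boundaries A G F i j" and ?Z = "tensor_cycles A G F i j"
  interpret M: module A ?Fi by (rule free_module_module)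
  interpret M': module A "cplx_module A F (Suc i)" by (rule free_module_module)
  interpret I: ideal "irrelevant_ideal A G" A by (rule irrelevant_ideal_ideal)
  have bdhom: "bd F l \<in> graded_hom A (cplx_module A F (Suc l)) (cplx_grading A G F (Suc l))
                                (cplx_module A F l) (cplx_grading A G F l)" for l
    using F unfolding graded_free_resolution_def by blast
  have N: "n \<in> ?N \<longleftrightarrow> (\<exists>y\<in>cplx_grading A G F (Suc i) j.
      \<exists>f\<in>irrelevant_part A G F i \<inter> cplx_grading A G F i j. n = bd F i y \<oplus>\<^bsub>?Fi\<^esub> f)" for n
    unfolding tensor_boundaries_def set_add_def' by auto
  have Nadd: "m \<oplus>\<^bsub>?Fi\<^esub> n \<in> ?N" if mn: "m \<in> ?N" "n \<in> ?N" for m n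
  proof -
    obtain y f y' f' where
      y: "y \<in> cplx_grading A G F (Suc i) j" "y' \<in> cplx_grading A G F (Suc i) j"
      and f: "f \<in> irrelevant_part A G F i \<inter> cplx_grading A G F i j"
        "f' \<in> irrelevant_part A G F i \<inter> cplx_grading A G F i j"
      and eq: "m = bd F i y \<oplus>\<^bsub>?Fi\<^esub> f" "n = bd F i y' \<oplus>\<^bsub>?Fi\<^esub> f'"
      using mn unfolding N by blast
    have c: "y \<in> carrier (cplx_module A F (Suc i))" "y' \<in> carrier (cplx_module A F (Suc i))"
      "f \<in> carrier ?Fi" "f' \<in> carrier ?Fi"
      using free_grading_closed[OF y(1)] free_grading_closed[OF y(2)] f
        free_grading_closed[of f _ _ j] free_grading_closed[of f' _ _ j] by auto
    have "m \<oplus>\<^bsub>?Fi\<^esub> n = bd F i (y \<oplus>\<^bsub>cplx_module A F (Suc i)\<^esub> y') \<oplus>\<^bsub>?Fi\<^esub> (f \<oplus>\<^bsub>?Fi\<^esub> f')"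
      using c graded_homD(1)[OF bdhom c(1)] graded_homD(1)[OF bdhom c(2)]
      by (simp add: eq graded_homD(2)[OF bdhom] M.a_ac)
    moreover have "f \<oplus>\<^bsub>?Fi\<^esub> f' \<in> irrelevant_part A G F i"
      using f c I.a_closed by (auto simp: irrelevant_part_def) (auto simp: free_module_simps)
    ultimately show ?thesis
      unfolding N using free_grading_add y f by blast
  qed
  have Nneg: "(\<ominus> \<one>) \<odot>\<^bsub>?Fi\<^esub> n \<in> ?N" if n: "n \<in> ?N" for n
  proof -
    obtain y f where y: "y \<in> cplx_grading A G F (Suc i) j"
      and f: "f \<in> irrelevant_part A G F i \<inter> cplx_grading A G F i j"
      and eq: "n = bd F i y \<oplus>\<^bsub>?Fi\<^esub> f"
      using n unfolding N by blast
    have c: "y \<in> carrier (cplx_module A F (Suc i))" "f \<in> carrier ?Fi"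
      using free_grading_closed[OF y] f free_grading_closed[of f _ _ j] by auto
    have "(\<ominus> \<one>) \<odot>\<^bsub>?Fi\<^esub> n =
        bd F i ((\<ominus> \<one>) \<odot>\<^bsub>cplx_module A F (Suc i)\<^esub> y) \<oplus>\<^bsub>?Fi\<^esub> (\<ominus> \<one>) \<odot>\<^bsub>?Fi\<^esub> f"
      using c graded_homD(1)[OF bdhom c(1)]
      by (simp add: eq graded_homD(3)[OF bdhom] M.smult_r_distr)
    moreover have "(\<ominus> \<one>) \<odot>\<^bsub>?Fi\<^esub> f \<in> irrelevant_part A G F i"
      using f c I.I_l_closed M.smult_closed[of "\<ominus> \<one>" f]
      by (auto simp: irrelevant_part_def) (auto simp: free_module_simps)
    ultimately show ?thesis
      unfolding N using free_grading_neg y f by blast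
  qed
  have Nc: "n \<in> carrier ?Fi" if n: "n \<in> ?N" for n
  proof -
    obtain y f where y: "y \<in> cplx_grading A G F (Suc i) j" and f: "f \<in> cplx_grading A G F i j"
      and eq: "n = bd F i y \<oplus>\<^bsub>?Fi\<^esub> f"
      using n unfolding N by blast
    show ?thesis
      unfolding eq
      using M.a_closed[OF graded_homD(1)[OF bdhom free_grading_closed[OF y]] free_grading_closed[OF f]] .
  qed
  have coset: "(\<Union>h\<in>?N. {h \<oplus>\<^bsub>?Fi\<^esub> a}) = ?N" if a: "a \<in> ?Z" for a
  proof -
    have aN: "a \<in> ?N" using a cycles by blast
    have "n = (n \<oplus>\<^bsub>?Fi\<^esub> (\<ominus> \<one>) \<odot>\<^bsub>?Fi\<^esub> a) \<oplus>\<^bsub>?Fi\<^esub> a" if "n \<in> ?N" for n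
      using Nc[OF that] Nc[OF aN] by (simp add: M.smult_l_minus M.a_assoc M.l_neg)
    moreover have "n \<oplus>\<^bsub>?Fi\<^esub> (\<ominus> \<one>) \<odot>\<^bsub>?Fi\<^esub> a \<in> ?N" if "n \<in> ?N" for n
      by (rule Nadd[OF that Nneg[OF aN]])
    ultimately have "?N \<subseteq> (\<Union>h\<in>?N. {h \<oplus>\<^bsub>?Fi\<^esub> a})" by blast
    then show ?thesis using Nadd[OF _ aN] by auto
  qed
  have "\<zero>\<^bsub>?Fi\<^esub> \<in> ?Z"
  proof (cases i)
    case (Suc l)
    have bdl: "bd F l \<in> graded_hom A ?Fi (cplx_grading A G F i) (cplx_module A F l) (cplx_grading A G F l)"
      using bdhom[of l] Suc by simp
    have "bd F l (\<lambda>_. \<zero>) \<in> irrelevant_part A G F l"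
      by (simp add: free_hom_zero[OF bdl] irrelevant_part_def free_module_carrier)
    then show ?thesis
      using free_grading_zero[of "gens F i" "gdeg F i" j]
      by (simp add: tensor_cycles_def Suc free_module_simps(1))
  qed (simp add: tensor_cycles_def free_grading_zero)
  then have "(\<Union>a\<in>?Z. {\<Union>h\<in>?N. {h \<oplus>\<^bsub>?Fi\<^esub> a}}) = {?N}"
    using coset by auto
  then show ?thesis
    unfolding tensor_homology_def FactGroup_def RCOSETS_def r_coset_def by simp
qed

text \<open>
  For \<open>I = A_+\<close> the complex \<open>F/IF\<close> is \<open>k \<otimes>\<^sub>A F\<close>. The acyclicity above holds for every resolution \<open>F\<close>,
  so nothing has to be known about the chosen one beyond its being a resolution.
\<close>

lemma koszul_algebra_linear_quotients:
  assumes Q: "\<Q> \<subseteq> linear_quotients \<Q>" and irr: "irrelevant_ideal A G \<in> linear_quotients \<Q>"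
  shows "koszul_algebra A G"
proof -
  define F where "F = chosen_resolution A G (residue_module A G) (residue_grading A G)"
  have "\<exists>F :: ('a, nat \<times> 'a \<times> 'a set, 'a set) free_complex.
      graded_free_resolution A G (residue_module A G) (residue_grading A G) F"
  proof (rule residue_resolution_exists)
    show "infinite (UNIV :: (nat \<times> 'a \<times> 'a set) set)"
      by (simp add: finite_prod)
    show "inj (\<lambda>a. (0, a, {}) :: nat \<times> 'a \<times> 'a set)" by (auto simp: inj_def)
    show "inj (\<lambda>n. (n, \<zero>, {}) :: nat \<times> 'a \<times> 'a set)" by (auto simp: inj_def)
  qed
  then have F: "graded_free_resolution A G (residue_module A G) (residue_grading A G) F"
    unfolding F_def chosen_resolution_def by (rule someI_ex)
  have bdhom: "bd F l \<in> graded_hom A (cplx_module A F (Suc l)) (cplx_grading A G F (Suc l))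
                                (cplx_module A F l) (cplx_grading A G F l)" for l
    using F unfolding graded_free_resolution_def by blast
  interpret I: ideal "irrelevant_ideal A G" A by (rule irrelevant_ideal_ideal)
  have "tensor_cycles A G F i j \<subseteq> tensor_boundaries A G F i j" if ij: "i \<noteq> j" for i j
  proof
    fix z assume z: "z \<in> tensor_cycles A G F i j"
    then have zg: "z \<in> cplx_grading A G F i j" by (simp add: tensor_cycles_def)
    have "bd F l z x \<in> irrelevant_ideal A G" if i: "i = Suc l" for l x
    proof -
      have "bd F l z \<in> irrelevant_part A G F l"
        using z i by (simp add: tensor_cycles_def)
      then show ?thesis
        using I.zero_closed unfolding irrelevant_part_def free_module_carrier
        by (cases "x \<in> gens F l") (simp_all del: split_paired_All)
    qed
    from linear_quotients_acyclic[OF F Q irr ij zg this]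
    obtain y f where y: "y \<in> cplx_grading A G F (Suc i) j" and f: "f \<in> cplx_grading A G F i j"
      "\<And>x. f x \<in> irrelevant_ideal A G" and z_eq: "z = bd F i y \<oplus>\<^bsub>cplx_module A F i\<^esub> f"
      by blast
    have "f \<in> irrelevant_part A G F i \<inter> cplx_grading A G F i j"
      using f free_grading_closed[OF f(1)] by (simp add: irrelevant_part_def)
    then show "z \<in> tensor_boundaries A G F i j"
      unfolding tensor_boundaries_def set_add_def' z_eq using y by blast
  qed
  then show ?thesis
    unfolding koszul_algebra_def Tor_group_def F_def[symmetric]
    by (intro allI impI tensor_homology_trivial[OF F])
qed

end

section \<open>Homogeneous parts and values of polynomials\<close>

abbreviation (input) pm_lookup where "pm_lookup \<equiv> Poly_Mapping.lookup"
abbreviation (input) pm_single where "pm_single \<equiv> Poly_Mapping.single"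

definition mdeg :: "('n::finite \<Rightarrow>\<^sub>0 nat) \<Rightarrow> nat" where
  "mdeg m = (\<Sum>i\<in>UNIV. pm_lookup m i)"

definition hpart :: "nat \<Rightarrow> ('n::finite, 'k::field) mpoly \<Rightarrow> ('n, 'k) mpoly" where
  "hpart d f = (\<Sum>m | m \<in> Poly_Mapping.keys f \<and> mdeg m = d. pm_single m (pm_lookup f m))"

lemma homogeneous_iff: "homogeneous d f \<longleftrightarrow> (\<forall>m. pm_lookup f m \<noteq> 0 \<longrightarrow> mdeg m = d)"
  by (auto simp: homogeneous_def mdeg_def in_keys_iff)

lemma mdeg_add: "mdeg (m + n) = mdeg m + mdeg n"
  by (simp add: mdeg_def lookup_add sum.distrib)

lemma mdeg_single: "mdeg (pm_single i e) = e"
  by (simp add: mdeg_def lookup_single when_def)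

lemma lookup_hpart: "pm_lookup (hpart d f) m = (if mdeg m = d then pm_lookup f m else 0)"
proof -
  have "pm_lookup (hpart d f) m = (\<Sum>m' | m' \<in> Poly_Mapping.keys f \<and> mdeg m' = d. if m' = m then pm_lookup f m' else 0)"
    unfolding hpart_def lookup_sum by (intro sum.cong) (auto simp: lookup_single when_def)
  also have "\<dots> = (if mdeg m = d then pm_lookup f m else 0)"
    by (auto simp: sum.delta' not_in_keys_iff_lookup_eq_zero)
  finally show ?thesis .
qed

lemma homogeneous_hpart: "homogeneous d (hpart d f)"
  by (auto simp: homogeneous_iff lookup_hpart)

lemma hpart_homogeneous: "homogeneous d f \<Longrightarrow> hpart e f = (if e = d then f else 0)"
  by (intro poly_mapping_eqI) (auto simp: homogeneous_iff lookup_hpart)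

lemma hpart_add: "hpart d (f + g) = hpart d f + hpart d g"
  by (intro poly_mapping_eqI) (simp add: lookup_hpart lookup_add)

lemma hpart_zero [simp]: "hpart d 0 = 0"
  by (intro poly_mapping_eqI) (simp add: lookup_hpart)

lemma hpart_minus: "hpart d (f - g) = hpart d f - hpart d g"
  by (intro poly_mapping_eqI) (simp add: lookup_hpart lookup_minus)

lemma hpart_sum: "hpart d (sum f Y) = (\<Sum>x\<in>Y. hpart d (f x))"
  by (induction Y rule: infinite_finite_induct) (auto simp: hpart_add)

lemma hpart_hpart: "hpart e (hpart d f) = (if e = d then hpart d f else 0)"
  by (rule hpart_homogeneous[OF homogeneous_hpart])

lemma homogeneous_zero [simp]: "homogeneous d 0"
  by (simp add: homogeneous_def)

lemma homogeneous_add: "\<lbrakk>homogeneous d f; homogeneous d g\<rbrakk> \<Longrightarrow> homogeneous d (f + g)"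
  by (auto simp: homogeneous_iff lookup_add) (metis add_0)

lemma homogeneous_minus: "\<lbrakk>homogeneous d f; homogeneous d g\<rbrakk> \<Longrightarrow> homogeneous d (f - g)"
  by (auto simp: homogeneous_iff lookup_minus) (metis diff_0_right)

lemma homogeneous_sum: "(\<And>x. x \<in> Y \<Longrightarrow> homogeneous d (f x)) \<Longrightarrow> homogeneous d (sum f Y)"
  by (induction Y rule: infinite_finite_induct) (auto intro: homogeneous_add)

lemma homogeneous_single: "homogeneous (mdeg m) (pm_single m c)"
  by (auto simp: homogeneous_iff lookup_single when_def)

lemma homogeneous_mult:
  assumes "homogeneous d f" "homogeneous e g"
  shows "homogeneous (d + e) (f * g)"
proof -
  have "mdeg m = d + e" if m: "m \<in> Poly_Mapping.keys (f * g)" for m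
  proof -
    obtain a b where "m = a + b" "a \<in> Poly_Mapping.keys f" "b \<in> Poly_Mapping.keys g"
      using subsetD[OF keys_mult[of f g] m] by blast
    then show ?thesis
      using assms by (simp add: homogeneous_def mdeg_add flip: mdeg_def)
  qed
  then show ?thesis by (simp add: homogeneous_def mdeg_def)
qed

lemma homogeneous_power: "homogeneous d f \<Longrightarrow> homogeneous (k * d) (f ^ k)"
proof (induction k)
  case 0
  show ?case
    using homogeneous_single[of "0 :: 'a \<Rightarrow>\<^sub>0 nat" "1 :: 'b"] by (simp add: mdeg_def)
next
  case (Suc k)
  then show ?case using homogeneous_mult[of d f "k * d" "f ^ k"] by simp
qed

lemma sum_hpart: "\<exists>D. f = (\<Sum>d\<le>D. hpart d f)"
proof -
  have "finite (mdeg ` Poly_Mapping.keys f)" by simp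
  then obtain D where D: "\<And>m. m \<in> Poly_Mapping.keys f \<Longrightarrow> mdeg m \<le> D"
    by (meson finite_nat_set_iff_bounded_le image_eqI)
  have "pm_lookup f m = pm_lookup (\<Sum>d\<le>D. hpart d f) m" for m
  proof (cases "m \<in> Poly_Mapping.keys f")
    case True
    then show ?thesis using D by (simp add: lookup_sum lookup_hpart)
  next
    case False
    then have "pm_lookup f m = 0" by (simp add: in_keys_iff)
    then show ?thesis by (simp add: lookup_sum lookup_hpart)
  qed
  then show ?thesis by (intro exI poly_mapping_eqI)
qed

lemma mpoly_homogeneous_induct [case_names zero add]:
  assumes "P 0" and "\<And>f h k. \<lbrakk>P f; homogeneous k h\<rbrakk> \<Longrightarrow> P (f + h)"
  shows "P f"
proof -
  obtain D where D: "f = (\<Sum>d\<le>D. hpart d f)" using sum_hpart by blast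
  have "P (\<Sum>d\<in>Y. hpart d f)" if "finite Y" for Y
    using that
  proof induction
    case (insert d Y)
    then show ?case
      using assms(2)[OF insert.IH homogeneous_hpart[of d f]] by (simp add: add.commute)
  qed (use assms in simp)
  then show ?thesis using D by (metis finite_atMost)
qed

lemma hpart_mult:
  assumes w: "homogeneous e w"
  shows "hpart n (f * w) = (if e \<le> n then hpart (n - e) f * w else 0)"
proof (induction f rule: mpoly_homogeneous_induct)
  case (add f h k)
  have "hpart n (h * w) = (if e \<le> n then hpart (n - e) h * w else 0)"
    using hpart_homogeneous[OF homogeneous_mult[OF add(2) w], of n]
      hpart_homogeneous[OF add(2), of "n - e"] by auto
  then show ?case using add by (simp add: hpart_add distrib_right)
qed simp

lemma mpoly_eq_sum_single: "f = (\<Sum>m\<in>Poly_Mapping.keys f. pm_single m (pm_lookup f m))"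
proof (rule poly_mapping_eqI)
  fix m
  have "(\<Sum>m'\<in>Poly_Mapping.keys f. pm_lookup (pm_single m' (pm_lookup f m')) m) =
      (\<Sum>m'\<in>Poly_Mapping.keys f. if m' = m then pm_lookup f m' else 0)"
    by (intro sum.cong) (auto simp: lookup_single when_def)
  also have "\<dots> = pm_lookup f m"
    by (auto simp: sum.delta' not_in_keys_iff_lookup_eq_zero)
  finally show "pm_lookup f m = pm_lookup (\<Sum>m\<in>Poly_Mapping.keys f. pm_single m (pm_lookup f m)) m"
    by (simp add: lookup_sum)
qed

definition mon_eval :: "('n::finite \<Rightarrow>\<^sub>0 nat) \<Rightarrow> 'k::field ^ 'n \<Rightarrow> 'k" where
  "mon_eval m v = (\<Prod>i\<in>UNIV. (v $ i) ^ pm_lookup m i)"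

lemma mon_eval_add: "mon_eval (m + n) v = mon_eval m v * mon_eval n v"
  by (simp add: mon_eval_def lookup_add power_add prod.distrib)

lemma mon_eval_scale: "mon_eval m (c *s v) = c ^ mdeg m * mon_eval m v"
  by (simp add: mon_eval_def mdeg_def power_mult_distrib prod.distrib power_sum)

lemma poly_eval_superset:
  assumes "finite K" "Poly_Mapping.keys f \<subseteq> K"
  shows "poly_eval f v = (\<Sum>m\<in>K. pm_lookup f m * mon_eval m v)"
  unfolding poly_eval_def mon_eval_def[symmetric]
  using assms by (intro sum.mono_neutral_left) (auto simp: in_keys_iff)

lemma poly_eval_add: "poly_eval (f + g) v = poly_eval f v + poly_eval g v"
proof -
  let ?K = "Poly_Mapping.keys f \<union> Poly_Mapping.keys g"
  have "poly_eval (f + g) v = (\<Sum>m\<in>?K. pm_lookup (f + g) m * mon_eval m v)"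
    by (intro poly_eval_superset keys_add) simp
  also have "\<dots> = (\<Sum>m\<in>?K. pm_lookup f m * mon_eval m v) + (\<Sum>m\<in>?K. pm_lookup g m * mon_eval m v)"
    by (simp add: lookup_add distrib_right sum.distrib)
  also have "\<dots> = poly_eval f v + poly_eval g v"
    using poly_eval_superset[of ?K f v] poly_eval_superset[of ?K g v] by simp
  finally show ?thesis .
qed

lemma poly_eval_zero [simp]: "poly_eval 0 v = 0"
  by (simp add: poly_eval_def)

lemma poly_eval_minus: "poly_eval (f - g) v = poly_eval f v - poly_eval g v"
  using poly_eval_add[of "f - g" g v] by simp

lemma poly_eval_sum: "poly_eval (sum f Y) v = (\<Sum>x\<in>Y. poly_eval (f x) v)"
  by (induction Y rule: infinite_finite_induct) (auto simp: poly_eval_add)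

lemma poly_eval_single: "poly_eval (pm_single m c) v = c * mon_eval m v"
  using poly_eval_superset[of "{m}" "pm_single m c" v] by simp

lemma poly_eval_const: "poly_eval (pm_single 0 c) v = c"
  by (simp add: poly_eval_single mon_eval_def)

lemma poly_eval_mult: "poly_eval (f * g) v = poly_eval f v * poly_eval g v"
proof -
  let ?K = "Poly_Mapping.keys f" and ?L = "Poly_Mapping.keys g"
  have "f * g = (\<Sum>m\<in>?K. pm_single m (pm_lookup f m)) * (\<Sum>n\<in>?L. pm_single n (pm_lookup g n))"
    using mpoly_eq_sum_single[of f] mpoly_eq_sum_single[of g] by simp
  also have "\<dots> = (\<Sum>m\<in>?K. \<Sum>n\<in>?L. pm_single (m + n) (pm_lookup f m * pm_lookup g n))"
    by (simp add: sum_product mult_single)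
  finally have "poly_eval (f * g) v =
      (\<Sum>m\<in>?K. \<Sum>n\<in>?L. (pm_lookup f m * mon_eval m v) * (pm_lookup g n * mon_eval n v))"
    by (simp add: poly_eval_sum poly_eval_single mon_eval_add mult_ac)
  also have "\<dots> = poly_eval f v * poly_eval g v"
    by (simp add: sum_product poly_eval_def mon_eval_def)
  finally show ?thesis .
qed

lemma poly_eval_power: "poly_eval (f ^ k) v = poly_eval f v ^ k"
proof (induction k)
  case 0
  then show ?case using poly_eval_const[of 1 v] by simp
qed (simp add: poly_eval_mult)

lemma poly_eval_scale:
  assumes "homogeneous d f"
  shows "poly_eval f (c *s v) = c ^ d * poly_eval f v"
proof -
  have "poly_eval f (c *s v) = (\<Sum>m\<in>Poly_Mapping.keys f. pm_lookup f m * (c ^ d * mon_eval m v))"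
    unfolding poly_eval_def mon_eval_def[symmetric]
    using assms by (intro sum.cong) (auto simp: mon_eval_scale homogeneous_def mdeg_def)
  also have "\<dots> = c ^ d * poly_eval f v"
    by (simp add: poly_eval_def mon_eval_def sum_distrib_left mult_ac)
  finally show ?thesis .
qed

section \<open>Linear forms\<close>

definition lin :: "'k::field ^ 'n::finite \<Rightarrow> ('n, 'k) mpoly" where
  "lin c = (\<Sum>i\<in>UNIV. pm_single (pm_single i 1) (c $ i))"

lemma homogeneous_lin: "homogeneous 1 (lin (c :: 'k::field ^ 'n::finite))"
  unfolding lin_def
proof (rule homogeneous_sum)
  fix i :: 'n
  show "homogeneous 1 (pm_single (pm_single i (1::nat)) (c $ i))"
    using homogeneous_single[of "pm_single i (1::nat)" "c $ i"] by (simp only: mdeg_single)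
qed

lemma lin_add: "lin (a + b) = lin a + lin b"
  by (simp add: lin_def single_add sum.distrib)

lemma lin_scale: "lin (k *s a) = pm_single 0 k * lin a"
  by (simp add: lin_def sum_distrib_left mult_single)

lemma lin_zero [simp]: "lin 0 = 0"
  by (simp add: lin_def)

lemma poly_eval_lin: "poly_eval (lin c) v = (\<Sum>i\<in>UNIV. c $ i * v $ i)"
proof -
  have "mon_eval (pm_single i 1) v = v $ i" for i
  proof -
    have "mon_eval (pm_single i 1) v = (\<Prod>j\<in>UNIV. if j = i then v $ i else 1)"
      unfolding mon_eval_def by (intro prod.cong) (auto simp: lookup_single when_def)
    then show ?thesis by simp
  qed
  then show ?thesis by (simp add: lin_def poly_eval_sum poly_eval_single)
qed

lemma homogeneous_1_lin:
  assumes "homogeneous 1 f"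
  shows "\<exists>c. f = lin c"
proof -
  define c where "c = (\<chi> i. pm_lookup f (pm_single i 1))"
  have "pm_lookup f m = pm_lookup (lin c) m" for m
  proof (cases "mdeg m = 1")
    case True
    then obtain i where i: "pm_lookup m i = 1" "\<And>j. j \<noteq> i \<Longrightarrow> pm_lookup m j = 0"
      unfolding mdeg_def sum_eq_1_iff[OF finite_class.finite_UNIV] by (metis UNIV_I)
    have "m = pm_single i 1"
      using i by (intro poly_mapping_eqI) (auto simp: lookup_single when_def)
    moreover have "pm_single j (1::nat) = pm_single i 1 \<longleftrightarrow> j = i" for j
      by (metis lookup_single_eq lookup_single_not_eq zero_neq_one)
    ultimately show ?thesis
      by (simp add: lin_def c_def lookup_sum lookup_single when_def)
  next
    case False
    then show ?thesis
      using assms homogeneous_lin[of c] by (metis homogeneous_iff)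
  qed
  then show ?thesis by (intro exI poly_mapping_eqI)
qed

text \<open>
  The functional is read off from a row of the matrix of an endomorphism of \<open>k\<^sup>n\<close> which extends its
  prescribed values, placed in the \<open>i\<close>-th coordinate.
\<close>

lemma linear_form_extends:
  fixes B :: "('k::field ^ 'n::finite) set" and q :: "'k ^ 'n"
  assumes B: "vec.independent B" and q: "q \<in> B"
  shows "\<exists>c. \<forall>v\<in>B. poly_eval (lin c) v = (if v = q then 1 else 0)"
proof -
  fix i :: 'n
  let ?g = "\<lambda>v. if v = q then axis i 1 else (0 :: 'k ^ 'n)"
  obtain g where g: "Vector_Spaces.linear (*s) (*s) g" "\<forall>v\<in>B. g v = ?g v"
    using vec.linear_independent_extend[OF B, of ?g] by blast
  define c where "c = (\<chi> j. matrix g $ i $ j)"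
  have "g v = matrix g *v v" for v
    using matrix_works[OF g(1)] by simp
  then have "poly_eval (lin c) v = g v $ i" for v
    by (simp add: poly_eval_lin c_def matrix_vector_mult_def)
  then show ?thesis using g(2) by (intro exI[of _ c]) (auto simp: axis_def)
qed

lemma linear_form_separates:
  fixes W :: "('k::field ^ 'n::finite) set" and v :: "'k ^ 'n"
  assumes W: "vec.subspace W" and v: "v \<notin> W"
  shows "\<exists>c. (\<forall>u\<in>W. poly_eval (lin c) u = 0) \<and> poly_eval (lin c) v \<noteq> 0"
proof -
  obtain B where B: "B \<subseteq> W" "vec.independent B" "W \<subseteq> vec.span B"
    using vec.basis_exists by metis
  have "v \<notin> vec.span B" using v B(1) W vec.span_minimal by blast
  then have "vec.independent (insert v B)" using B(2) by (simp add: vec.independent_insert)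
  then obtain c where c: "\<forall>u\<in>insert v B. poly_eval (lin c) u = (if u = v then 1 else 0)"
    using linear_form_extends by blast
  have "poly_eval (lin c) u = 0" if "u \<in> W" for u
  proof -
    have "u \<in> vec.span B" using that B by blast
    then show ?thesis
    proof (induction rule: vec.span_induct_alt)
      case base
      show ?case by (simp add: poly_eval_lin)
    next
      case (step k b u)
      have "poly_eval (lin c) b = 0" using c step(1) v B(1) by auto
      moreover have "poly_eval (lin c) (k *s b + u) = k * poly_eval (lin c) b + poly_eval (lin c) u"
        by (simp add: poly_eval_lin sum.distrib sum_distrib_left algebra_simps)
      ultimately show ?case using step by simp
    qed
  qed
  then show ?thesis using c by (intro exI[of _ c]) auto
qed

section \<open>Ideals of polynomials vanishing on points\<close>

definition rep :: "('k::field ^ 'n::finite) set \<Rightarrow> 'k ^ 'n" where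
  "rep p = (SOME v. v \<noteq> 0 \<and> p = vec.span {v})"

lemma rep_nonzero: "p \<in> proj_points \<Longrightarrow> rep p \<noteq> 0"
  and span_rep: "p \<in> proj_points \<Longrightarrow> vec.span {rep p} = p"
proof -
  assume "p \<in> proj_points"
  then have "\<exists>v. v \<noteq> 0 \<and> p = vec.span {v}" by (auto simp: proj_points_def)
  then have "rep p \<noteq> 0 \<and> p = vec.span {rep p}" unfolding rep_def by (rule someI_ex)
  then show "rep p \<noteq> 0" "vec.span {rep p} = p" by auto
qed

lemma vanishes_at_iff:
  assumes p: "p \<in> proj_points" and f: "homogeneous d f"
  shows "vanishes_at f p \<longleftrightarrow> poly_eval f (rep p) = 0"
proof
  assume "vanishes_at f p"
  moreover have "rep p \<in> p" using vec.span_base[of "rep p" "{rep p}"] span_rep[OF p] by simp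
  ultimately show "poly_eval f (rep p) = 0"
    using rep_nonzero[OF p] by (simp add: vanishes_at_def)
next
  assume z: "poly_eval f (rep p) = 0"
  have "poly_eval f v = 0" if "v \<in> p" for v
  proof -
    have "v \<in> vec.span {rep p}" using that span_rep[OF p] by simp
    then obtain k where "v = k *s rep p" unfolding vec.span_singleton by blast
    then show ?thesis using z by (simp add: poly_eval_scale[OF f])
  qed
  then show "vanishes_at f p" by (simp add: vanishes_at_def)
qed

definition poly_ideal :: "'r::comm_ring_1 set \<Rightarrow> bool" where
  "poly_ideal I \<longleftrightarrow> 0 \<in> I \<and> (\<forall>a\<in>I. \<forall>b\<in>I. a + b \<in> I) \<and> (\<forall>f. \<forall>a\<in>I. f * a \<in> I)"

lemma poly_idealD:
  assumes "poly_ideal I"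
  shows "0 \<in> I" "\<lbrakk>a \<in> I; b \<in> I\<rbrakk> \<Longrightarrow> a + b \<in> I" "a \<in> I \<Longrightarrow> f * a \<in> I" "a \<in> I \<Longrightarrow> - a \<in> I"
    "\<lbrakk>a \<in> I; b \<in> I\<rbrakk> \<Longrightarrow> a - b \<in> I"
proof -
  show add: "a + b \<in> I" if "a \<in> I" "b \<in> I" for a b using assms that by (auto simp: poly_ideal_def)
  show mult: "f * a \<in> I" if "a \<in> I" for f a using assms that by (auto simp: poly_ideal_def)
  show "0 \<in> I" using assms by (auto simp: poly_ideal_def)
  show neg: "- a \<in> I" if "a \<in> I" for a using mult[OF that, of "- 1"] by simp
  show "a - b \<in> I" if "a \<in> I" "b \<in> I" for a b using add[OF that(1) neg[OF that(2)]] by simp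
qed

lemma poly_ideal_sum:
  "\<lbrakk>poly_ideal I; \<And>x. x \<in> Y \<Longrightarrow> f x \<in> I\<rbrakk> \<Longrightarrow> sum f Y \<in> I"
  by (induction Y rule: infinite_finite_induct) (auto dest: poly_idealD)

text \<open>
  The condition on the constant term makes \<open>van {}\<close> the ideal of the polynomials without constant
  term, whose image in the coordinate ring is the irrelevant ideal.
\<close>

definition van :: "('k::field ^ 'n::finite) set set \<Rightarrow> ('n, 'k) mpoly set" where
  "van T = {f. hpart 0 f = 0 \<and> (\<forall>p\<in>T. \<forall>d. poly_eval (hpart d f) (rep p) = 0)}"

lemma van_antimono: "T \<subseteq> U \<Longrightarrow> van U \<subseteq> van T"
  by (auto simp: van_def)

lemma hpart_van: "f \<in> van T \<Longrightarrow> hpart d f \<in> van T"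
  by (auto simp: van_def hpart_hpart)

lemma homogeneous_van:
  assumes "homogeneous d h" "d > 0"
  shows "h \<in> van T \<longleftrightarrow> (\<forall>p\<in>T. poly_eval h (rep p) = 0)"
  using assms by (auto simp: van_def hpart_homogeneous)

lemma poly_ideal_van: "poly_ideal (van T)"
proof -
  have add: "f + g \<in> van T" if "f \<in> van T" "g \<in> van T" for f g
    using that by (auto simp: van_def hpart_add poly_eval_add)
  have zero: "0 \<in> van T" by (simp add: van_def)
  have "f * g \<in> van T" if g: "g \<in> van T" for f g
  proof -
    have h: "f * hpart k g \<in> van T" for k
    proof (cases "k = 0")
      case True
      then show ?thesis using g zero by (simp add: van_def)
    next
      case False
      have "poly_eval (hpart k g) (rep p) = 0" if "p \<in> T" for p
        using g that by (auto simp: van_def)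
      then show ?thesis
        using False by (auto simp: van_def hpart_mult[OF homogeneous_hpart] poly_eval_mult)
    qed
    obtain D where D: "g = (\<Sum>k\<le>D. hpart k g)" using sum_hpart by blast
    have "(\<Sum>k\<in>Y. f * hpart k g) \<in> van T" if "finite Y" for Y
      using that by induction (auto simp: zero add h)
    then have "f * (\<Sum>k\<le>D. hpart k g) \<in> van T" by (simp add: sum_distrib_left)
    then show ?thesis by (simp flip: D)
  qed
  then show ?thesis using add zero by (auto simp: poly_ideal_def)
qed

lemma dual_linear_forms:
  assumes T: "linearly_independent_points T" "T \<subseteq> proj_points"
  shows "\<exists>x. \<forall>q\<in>T. \<forall>q'\<in>T. poly_eval (lin (x q)) (rep q') = (if q' = q then 1 else 0)"
proof -
  obtain r where r: "\<And>p. p \<in> T \<Longrightarrow> r p \<noteq> 0 \<and> p = vec.span {r p}" and ind: "vec.independent (r ` T)"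
    using T(1) unfolding linearly_independent_points_def by blast
  have inj: "r q' = r q \<longleftrightarrow> q' = q" if "q \<in> T" "q' \<in> T" for q q'
    using r[OF that(1)] r[OF that(2)] by metis
  have "\<exists>k. k \<noteq> 0 \<and> rep p = k *s r p" if p: "p \<in> T" for p
  proof -
    have pp: "p \<in> proj_points" using p T(2) by blast
    have "rep p \<in> p" using vec.span_base[of "rep p" "{rep p}"] span_rep[OF pp] by simp
    then have "rep p \<in> vec.span {r p}" using r[OF p] by blast
    then obtain k where "rep p = k *s r p" unfolding vec.span_singleton by blast
    then show ?thesis using rep_nonzero[OF pp] by (intro exI[of _ k]) auto
  qed
  then obtain k where k: "\<And>p. p \<in> T \<Longrightarrow> k p \<noteq> 0" "\<And>p. p \<in> T \<Longrightarrow> rep p = k p *s r p" by metis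
  have "\<exists>c. \<forall>q'\<in>T. poly_eval (lin c) (rep q') = (if q' = q then 1 else 0)" if q: "q \<in> T" for q
  proof -
    obtain c where c: "\<forall>v\<in>r ` T. poly_eval (lin c) v = (if v = r q then 1 else 0)"
      using linear_form_extends[OF ind] q by blast
    have "poly_eval (lin ((1 / k q) *s c)) (rep q') = (if q' = q then 1 else 0)" if q': "q' \<in> T" for q'
    proof -
      have "poly_eval (lin ((1 / k q) *s c)) (rep q') = (1 / k q) * (k q' * poly_eval (lin c) (r q'))"
        unfolding lin_scale poly_eval_mult poly_eval_const k(2)[OF q'] poly_eval_scale[OF homogeneous_lin]
        by simp
      then show ?thesis using c q' inj[OF q q'] k(1)[OF q] by auto
    qed
    then show ?thesis by blast
  qed
  then show ?thesis by metis
qed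

section \<open>Adjoining linear forms\<close>

definition adjoin :: "('n::finite, 'k::field) mpoly set \<Rightarrow> ('k ^ 'n) set \<Rightarrow> ('n, 'k) mpoly set" where
  "adjoin I W = {a + (\<Sum>c\<in>W. f c * lin c) | a f. a \<in> I}"

lemma adjoinI: "a \<in> I \<Longrightarrow> a + (\<Sum>c\<in>W. f c * lin c) \<in> adjoin I W"
  unfolding adjoin_def by blast

lemma adjoin_empty: "adjoin I {} = I"
  by (simp add: adjoin_def)

lemma adjoin_insert:
  assumes "finite W" "c \<notin> W"
  shows "adjoin I (insert c W) = {a + f * lin c | a f. a \<in> adjoin I W}"
proof (intro equalityI subsetI)
  fix g assume "g \<in> adjoin I (insert c W)"
  then obtain a f where "a \<in> I" "g = a + (\<Sum>d\<in>insert c W. f d * lin d)"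
    by (auto simp: adjoin_def)
  then have "g = (a + (\<Sum>d\<in>W. f d * lin d)) + f c * lin c" "a + (\<Sum>d\<in>W. f d * lin d) \<in> adjoin I W"
    using assms by (auto simp: adjoin_def add_ac)
  then show "g \<in> {a + f * lin c | a f. a \<in> adjoin I W}" by blast
next
  fix g assume "g \<in> {a + f * lin c | a f. a \<in> adjoin I W}"
  then obtain a f h where a: "a \<in> I" and g: "g = (a + (\<Sum>d\<in>W. f d * lin d)) + h * lin c"
    by (auto simp: adjoin_def)
  have "(\<Sum>d\<in>W. (f(c := h)) d * lin d) = (\<Sum>d\<in>W. f d * lin d)"
    using assms by (intro sum.cong) auto
  then have "g = a + (\<Sum>d\<in>insert c W. (f(c := h)) d * lin d)"
    using assms by (simp add: g add_ac)
  then show "g \<in> adjoin I (insert c W)" using a unfolding adjoin_def by blast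
qed

lemma poly_ideal_adjoin:
  assumes "poly_ideal I"
  shows "poly_ideal (adjoin I W)"
proof -
  have "0 \<in> adjoin I W"
    using adjoinI[OF poly_idealD(1)[OF assms], where f = "\<lambda>_. 0"] by simp
  moreover have "g + h \<in> adjoin I W" if "g \<in> adjoin I W" "h \<in> adjoin I W" for g h
  proof -
    obtain a f a' f' where "a \<in> I" "a' \<in> I" "g = a + (\<Sum>c\<in>W. f c * lin c)" "h = a' + (\<Sum>c\<in>W. f' c * lin c)"
      using \<open>g \<in> adjoin I W\<close> \<open>h \<in> adjoin I W\<close> by (auto simp: adjoin_def)
    then have "g + h = (a + a') + (\<Sum>c\<in>W. (f c + f' c) * lin c)" "a + a' \<in> I"
      using poly_idealD(2)[OF assms] by (auto simp: algebra_simps sum.distrib)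
    then show ?thesis
      using adjoinI[of "a + a'" I "\<lambda>c. f c + f' c" W] by simp
  qed
  moreover have "h * g \<in> adjoin I W" if g: "g \<in> adjoin I W" for g h
  proof -
    obtain a f where "a \<in> I" "g = a + (\<Sum>c\<in>W. f c * lin c)"
      using g by (auto simp: adjoin_def)
    then have "h * g = h * a + (\<Sum>c\<in>W. h * f c * lin c)" "h * a \<in> I"
      using poly_idealD(3)[OF assms] by (auto simp: distrib_left sum_distrib_left mult.assoc)
    then show ?thesis
      using adjoinI[of "h * a" I "\<lambda>c. h * f c" W] by simp
  qed
  ultimately show ?thesis by (auto simp: poly_ideal_def)
qed

lemma adjoin_base: "I \<subseteq> adjoin I W"
proof
  fix a assume "a \<in> I"
  then show "a \<in> adjoin I W"
    using adjoinI[of a I "\<lambda>_. 0" W] by simp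
qed

lemma lin_in_adjoin:
  assumes "poly_ideal I" "finite W" "c \<in> W"
  shows "lin c \<in> adjoin I W"
proof -
  have "(\<Sum>d\<in>W. (if d = c then 1 else 0) * lin d) = (\<Sum>d\<in>W. if d = c then lin c else 0)"
    by (intro sum.cong) auto
  also have "\<dots> = lin c" using assms by simp
  finally show ?thesis
    using adjoinI[OF poly_idealD(1)[OF assms(1)], where f = "\<lambda>d. if d = c then 1 else 0" and W = W]
    by simp
qed

lemma hpart_adjoin:
  assumes I: "\<And>f d. f \<in> I \<Longrightarrow> hpart d f \<in> I" and g: "g \<in> adjoin I W"
  shows "hpart d g \<in> adjoin I W"
proof -
  obtain a f where a: "a \<in> I" "g = a + (\<Sum>c\<in>W. f c * lin c)"
    using g by (auto simp: adjoin_def)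
  define f' where "f' c = (if 1 \<le> d then hpart (d - 1) (f c) else 0)" for c
  have "hpart d (f c * lin c) = f' c * lin c" for c
    by (simp add: f'_def hpart_mult[OF homogeneous_lin])
  then have "hpart d g = hpart d a + (\<Sum>c\<in>W. f' c * lin c)"
    by (simp add: a(2) hpart_add hpart_sum)
  then show ?thesis using I[OF a(1)] unfolding adjoin_def by blast
qed

text \<open>
  This is where the linear independence of \<open>T'\<close> enters. With linear forms \<open>x\<^sub>q\<close> dual to the points
  of \<open>T'\<close>, a linear form \<open>c\<close> which vanishes on \<open>T\<close> but not at \<open>q\<close> yields the element \<open>x\<^sub>q\<^sup>d\<^sup>-\<^sup>1 c\<close> of
  degree \<open>d \<ge> 2\<close> in the ideal, which vanishes on \<open>T \<union> T'\<close> except at \<open>q\<close>. Subtracting multiples of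
  these elements from the degree \<open>d\<close> part of \<open>g\<close> leaves a polynomial vanishing on \<open>T \<union> T'\<close>. In degree
  1 there is no factor \<open>x\<^sub>q\<close> left, whence the condition on the linear part of \<open>g\<close>.
\<close>

lemma vanishing_in_adjoin:
  fixes T T' :: "('k::field ^ 'n::finite) set set"
  assumes fin: "finite T'" "finite W"
    and dual: "\<And>q q'. \<lbrakk>q \<in> T'; q' \<in> T'\<rbrakk> \<Longrightarrow> poly_eval (lin (x q)) (rep q') = (if q' = q then 1 else 0)"
    and W: "\<And>c p. \<lbrakk>c \<in> W; p \<in> T\<rbrakk> \<Longrightarrow> poly_eval (lin c) (rep p) = 0"
    and g: "g \<in> van T" "hpart 1 g = 0"
      "\<And>q d. \<lbrakk>q \<in> T'; \<forall>c\<in>W. poly_eval (lin c) (rep q) = 0\<rbrakk> \<Longrightarrow> poly_eval (hpart d g) (rep q) = 0"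
  shows "g \<in> adjoin (van (T \<union> T')) W"
proof -
  let ?J = "adjoin (van (T \<union> T')) W"
  have J: "poly_ideal ?J" by (rule poly_ideal_adjoin[OF poly_ideal_van])
  have sel: "\<forall>q. \<exists>c. (\<exists>c\<in>W. poly_eval (lin c) (rep q) \<noteq> 0) \<longrightarrow> c \<in> W \<and> poly_eval (lin c) (rep q) \<noteq> 0"
    by blast
  then obtain c where c: "\<And>q. \<exists>c\<in>W. poly_eval (lin c) (rep q) \<noteq> 0 \<Longrightarrow>
      c q \<in> W \<and> poly_eval (lin (c q)) (rep q) \<noteq> 0"
    using choice[OF sel] by blast
  define T2 where "T2 = {q \<in> T'. \<exists>c\<in>W. poly_eval (lin c) (rep q) \<noteq> 0}"
  have T2: "finite T2" "\<And>q. q \<in> T2 \<Longrightarrow> q \<in> T'" "\<And>q. q \<in> T2 \<Longrightarrow> c q \<in> W"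
      "\<And>q. q \<in> T2 \<Longrightarrow> poly_eval (lin (c q)) (rep q) \<noteq> 0"
    using fin c by (auto simp: T2_def)
  have part: "hpart d g \<in> ?J" for d
  proof (cases "d < 2")
    case True
    then have "d = 0 \<or> d = 1" by auto
    then have "hpart d g = 0" using g by (auto simp: van_def)
    then show ?thesis using poly_idealD(1)[OF J] by simp
  next
    case False
    then obtain e where e: "d = Suc (Suc e)" by (metis add_2_eq_Suc le_Suc_ex not_less)
    define b where "b q = poly_eval (hpart d g) (rep q) / poly_eval (lin (c q)) (rep q)" for q
    define h where "h = (\<Sum>q\<in>T2. (pm_single 0 (b q) * lin (x q) ^ Suc e) * lin (c q))"
    have hJ: "h \<in> ?J"
      unfolding h_def
      using T2 by (intro poly_ideal_sum[OF J] poly_idealD(3)[OF J] lin_in_adjoin poly_ideal_van fin) auto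
    have hh: "homogeneous d h"
      unfolding h_def
    proof (rule homogeneous_sum)
      fix q
      have "homogeneous 0 (pm_single 0 (b q) :: ('n, 'k) mpoly)"
        using homogeneous_single[of "0 :: 'n \<Rightarrow>\<^sub>0 nat" "b q"] by (simp add: mdeg_def)
      from homogeneous_mult[OF homogeneous_mult[OF this homogeneous_power[OF homogeneous_lin, of "Suc e" "x q"]]
        homogeneous_lin[of "c q"]]
      show "homogeneous d (pm_single 0 (b q) * lin (x q) ^ Suc e * lin (c q))" by (simp add: e)
    qed
    have ev: "poly_eval h v = (\<Sum>q\<in>T2. b q * poly_eval (lin (x q)) v ^ Suc e * poly_eval (lin (c q)) v)" for v
      by (simp only: h_def poly_eval_sum poly_eval_mult poly_eval_power poly_eval_const)
    have evT: "poly_eval h (rep p) = 0" if "p \<in> T" for p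
      unfolding ev using T2(3) W[OF _ that] by (intro sum.neutral) simp
    have evT': "poly_eval h (rep p) = poly_eval (hpart d g) (rep p)" if p: "p \<in> T'" for p
    proof -
      have "poly_eval h (rep p) = (\<Sum>q\<in>T2. if q = p then b q * poly_eval (lin (c q)) (rep p) else 0)"
        unfolding ev using T2(2) dual[OF _ p] by (intro sum.cong) auto
      also have "\<dots> = (if p \<in> T2 then b p * poly_eval (lin (c p)) (rep p) else 0)"
        using T2(1) by simp
      also have "\<dots> = poly_eval (hpart d g) (rep p)"
        using T2(4)[of p] g(3)[OF p, of d] p by (auto simp: b_def T2_def)
      finally show ?thesis .
    qed
    have "poly_eval (hpart d g) (rep p) = 0" if "p \<in> T" for p
      using g(1) that by (auto simp: van_def)
    then have "hpart d g - h \<in> van (T \<union> T')"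
      using homogeneous_van[OF homogeneous_minus[OF homogeneous_hpart hh], where T = "T \<union> T'"] e evT evT'
      by (auto simp: poly_eval_minus)
    then have "hpart d g - h + h \<in> ?J"
      using adjoin_base hJ poly_idealD(2)[OF J] by blast
    then show ?thesis by simp
  qed
  obtain D where D: "g = (\<Sum>d\<le>D. hpart d g)" using sum_hpart by blast
  have "(\<Sum>d\<le>D. hpart d g) \<in> ?J" by (rule poly_ideal_sum[OF J part])
  then show ?thesis by (simp flip: D)
qed

text \<open>
  For elements of \<open>van T\<close> of degree at least 2, membership in the adjoined ideal only depends on the
  values at the points of \<open>T'\<close> where all of \<open>W\<close> vanishes, and of these points \<open>f w\<close> can only fail to vanish at those where
  \<open>w\<close> does not vanish. The constant term of \<open>f\<close> is zero because \<open>w\<close> itself is not in the ideal.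
\<close>

lemma adjoin_colon:
  fixes T T' :: "('k::field ^ 'n::finite) set set"
  assumes fin: "finite T'" "finite W"
    and dual: "\<And>q q'. \<lbrakk>q \<in> T'; q' \<in> T'\<rbrakk> \<Longrightarrow> poly_eval (lin (x q)) (rep q') = (if q' = q then 1 else 0)"
    and W: "\<And>c p. \<lbrakk>c \<in> W; p \<in> T\<rbrakk> \<Longrightarrow> poly_eval (lin c) (rep p) = 0"
    and w: "\<And>p. p \<in> T \<Longrightarrow> poly_eval (lin w) (rep p) = 0" "lin w \<notin> adjoin (van (T \<union> T')) W"
  shows "{f. f * lin w \<in> adjoin (van (T \<union> T')) W} =
    van {q \<in> T'. poly_eval (lin w) (rep q) \<noteq> 0 \<and> (\<forall>c\<in>W. poly_eval (lin c) (rep q) = 0)}"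
    (is "?L = van ?P")
proof (intro equalityI subsetI)
  let ?J = "adjoin (van (T \<union> T')) W"
  have J: "poly_ideal ?J" by (rule poly_ideal_adjoin[OF poly_ideal_van])
  fix f assume "f \<in> ?L"
  then have f: "f * lin w \<in> ?J" by simp
  have "hpart 0 f = 0"
  proof (rule ccontr)
    assume nz: "hpart 0 f \<noteq> 0"
    have "hpart 1 (f * lin w) = hpart 0 f * lin w" by (simp add: hpart_mult[OF homogeneous_lin])
    then have in_J: "hpart 0 f * lin w \<in> ?J" using hpart_adjoin[OF hpart_van f, of 1] by simp
    define a where "a = pm_lookup f 0"
    have "hpart 0 f = pm_single 0 a"
    proof (rule poly_mapping_eqI)
      fix m
      show "pm_lookup (hpart 0 f) m = pm_lookup (pm_single 0 a) m"
      proof (cases "m = 0")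
        case True
        then show ?thesis by (simp add: lookup_hpart a_def mdeg_def)
      next
        case False
        then have "mdeg m \<noteq> 0" unfolding mdeg_def by (auto intro!: poly_mapping_eqI)
        then show ?thesis using False by (simp add: lookup_hpart lookup_single when_def)
      qed
    qed
    moreover from this nz have "a \<noteq> 0" by auto
    ultimately have "pm_single 0 (inverse a) * (hpart 0 f * lin w) = lin w"
      by (simp add: mult_single flip: mult.assoc)
    then show False using poly_idealD(3)[OF J in_J] w(2) by metis
  qed
  moreover have "poly_eval (hpart d f) (rep q) = 0" if q: "q \<in> ?P" for q d
  proof -
    have "poly_eval (hpart e g) (rep q) = 0" if g: "g \<in> ?J" for g e
    proof -
      obtain a h where a: "a \<in> van (T \<union> T')" "g = a + (\<Sum>c\<in>W. h c * lin c)"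
        using g by (auto simp: adjoin_def)
      have "poly_eval (hpart e (h c * lin c)) (rep q) = 0" if "c \<in> W" for c
        using q that by (auto simp: hpart_mult[OF homogeneous_lin] poly_eval_mult)
      moreover have "poly_eval (hpart e a) (rep q) = 0" using a(1) q by (auto simp: van_def)
      ultimately show ?thesis by (simp add: a(2) hpart_add hpart_sum poly_eval_add poly_eval_sum)
    qed
    then have "poly_eval (hpart (Suc d) (f * lin w)) (rep q) = 0" using f by blast
    then show ?thesis using q by (simp add: hpart_mult[OF homogeneous_lin] poly_eval_mult)
  qed
  ultimately show "f \<in> van ?P" by (simp add: van_def)
next
  fix f assume f: "f \<in> van ?P"
  have "f * lin w \<in> adjoin (van (T \<union> T')) W"
  proof (rule vanishing_in_adjoin[OF fin dual W])
    have f0: "hpart 0 f = 0" using f by (simp add: van_def)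
    show "f * lin w \<in> van T"
      using w(1) by (auto simp: van_def hpart_mult[OF homogeneous_lin] poly_eval_mult)
    show "hpart 1 (f * lin w) = 0" using f0 by (simp add: hpart_mult[OF homogeneous_lin])
    fix q d assume q: "q \<in> T'" "\<forall>c\<in>W. poly_eval (lin c) (rep q) = 0"
    show "poly_eval (hpart d (f * lin w)) (rep q) = 0"
      using f q by (cases "poly_eval (lin w) (rep q) = 0")
        (auto simp: van_def hpart_mult[OF homogeneous_lin] poly_eval_mult)
  qed auto
  then show "f \<in> ?L" by simp
qed

text \<open>
  The set \<open>W\<close> contains a basis of the space of linear forms vanishing on \<open>T\<close>, which takes care of
  the linear parts, and for each \<open>q\<close> a form separating \<open>q\<close> from \<open>T\<close>, so that \<open>W\<close> has no common zero
  in \<open>T'\<close> and everything of higher degree is covered as well.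
\<close>

lemma van_eq_adjoin:
  fixes T T' :: "('k::field ^ 'n::finite) set set"
  assumes fin: "finite T'"
    and dual: "\<And>q q'. \<lbrakk>q \<in> T'; q' \<in> T'\<rbrakk> \<Longrightarrow> poly_eval (lin (x q)) (rep q') = (if q' = q then 1 else 0)"
    and sep: "\<And>q. q \<in> T' \<Longrightarrow>
      \<exists>c. (\<forall>p\<in>T. poly_eval (lin c) (rep p) = 0) \<and> poly_eval (lin c) (rep q) \<noteq> 0"
  shows "\<exists>W. finite W \<and> (\<forall>c\<in>W. \<forall>p\<in>T. poly_eval (lin c) (rep p) = 0) \<and>
    van T = adjoin (van (T \<union> T')) W"
proof -
  define V where "V = {c. \<forall>p\<in>T. poly_eval (lin c) (rep p) = 0}"
  obtain B where B: "B \<subseteq> V" "vec.independent B" "V \<subseteq> vec.span B"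
    using vec.basis_exists by metis
  have "\<forall>q\<in>T'. \<exists>c. c \<in> V \<and> poly_eval (lin c) (rep q) \<noteq> 0"
    using sep by (auto simp: V_def)
  from bchoice[OF this]
  obtain s where s: "\<And>q. q \<in> T' \<Longrightarrow> s q \<in> V" "\<And>q. q \<in> T' \<Longrightarrow> poly_eval (lin (s q)) (rep q) \<noteq> 0"
    by blast
  define W where "W = B \<union> s ` T'"
  let ?J = "adjoin (van (T \<union> T')) W"
  have J: "poly_ideal ?J" by (rule poly_ideal_adjoin[OF poly_ideal_van])
  have W: "finite W" "W \<subseteq> V"
    using vec.finiteI_independent[OF B(2)] fin B(1) s(1) by (auto simp: W_def)
  have span: "lin c \<in> ?J" if "c \<in> vec.span B" for c
    using that
  proof (induction rule: vec.span_induct_alt)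
    case base
    show ?case using poly_idealD(1)[OF J] by simp
  next
    case (step k b y)
    have "lin b \<in> ?J" using step(1) W(1) by (intro lin_in_adjoin poly_ideal_van) (auto simp: W_def)
    then show ?case
      using step poly_idealD(2,3)[OF J] by (simp add: lin_add lin_scale)
  qed
  have "?J \<subseteq> van T"
  proof
    fix g assume "g \<in> ?J"
    then obtain a f where a: "a \<in> van (T \<union> T')" "g = a + (\<Sum>c\<in>W. f c * lin c)"
      by (auto simp: adjoin_def)
    have "lin c \<in> van T" if "c \<in> W" for c
      using that W(2) homogeneous_van[OF homogeneous_lin, where T = T] by (auto simp: V_def)
    then show "g \<in> van T"
      unfolding a(2) using a(1) van_antimono[of T "T \<union> T'"]
      by (intro poly_idealD(2)[OF poly_ideal_van] poly_ideal_sum[OF poly_ideal_van]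
        poly_idealD(3)[OF poly_ideal_van]) auto
  qed
  moreover have "van T \<subseteq> ?J"
  proof
    fix g assume g: "g \<in> van T"
    obtain c where c: "hpart 1 g = lin c" using homogeneous_1_lin[OF homogeneous_hpart] by blast
    have "poly_eval (lin c) (rep p) = 0" if "p \<in> T" for p
      using g that by (auto simp: van_def simp flip: c)
    then have 1: "hpart 1 g \<in> ?J" using span[of c] B(3) c by (auto simp: V_def)
    have "g - hpart 1 g \<in> ?J"
    proof (rule vanishing_in_adjoin[OF fin W(1) dual])
      show "poly_eval (lin c) (rep p) = 0" if "c \<in> W" "p \<in> T" for c p
        using that W(2) by (auto simp: V_def)
      show "g - hpart 1 g \<in> van T" by (rule poly_idealD(5)[OF poly_ideal_van g hpart_van[OF g]])
      show "hpart 1 (g - hpart 1 g) = 0" by (simp add: hpart_minus hpart_hpart)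
      show "poly_eval (hpart d (g - hpart 1 g)) (rep q) = 0"
        if "q \<in> T'" "\<forall>c\<in>W. poly_eval (lin c) (rep q) = 0" for q d
        using that s(2)[of q] by (auto simp: W_def)
    qed auto
    from poly_idealD(2)[OF J this 1] show "g \<in> ?J" by simp
  qed
  ultimately show ?thesis using W by (intro exI[of _ W]) (auto simp: V_def)
qed

section \<open>The coordinate ring of a finite set of points\<close>

lemma mpoly_ring_simps:
  "carrier (mpoly_ring :: ('n::finite, 'k::field) mpoly ring) = UNIV"
  "\<zero>\<^bsub>mpoly_ring :: ('n, 'k) mpoly ring\<^esub> = 0"
  "\<one>\<^bsub>mpoly_ring :: ('n, 'k) mpoly ring\<^esub> = 1"
  "f \<oplus>\<^bsub>mpoly_ring :: ('n, 'k) mpoly ring\<^esub> g = f + g"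
  "f \<otimes>\<^bsub>mpoly_ring :: ('n, 'k) mpoly ring\<^esub> g = f * g"
  by (simp_all add: ring_of_type_algebra_def)

lemma mpoly_ring_uminus: "\<ominus>\<^bsub>mpoly_ring :: ('n::finite, 'k::field) mpoly ring\<^esub> f = - f"
proof -
  interpret cring "mpoly_ring :: ('n, 'k) mpoly ring" by (rule cring_from_type_algebra)
  show ?thesis
    using minus_equality[of "- f" f] by (simp add: mpoly_ring_simps)
qed

lemma ideal_mpoly_ring_iff:
  fixes I :: "('n::finite, 'k::field) mpoly set"
  shows "ideal I mpoly_ring \<longleftrightarrow> poly_ideal I"
proof
  assume I: "ideal I mpoly_ring"
  interpret I: ideal I "mpoly_ring :: ('n, 'k) mpoly ring" by (rule I)
  note sub = additive_subgroup.zero_closed[OF ideal.axioms(1)[OF I]]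
    additive_subgroup.a_closed[OF ideal.axioms(1)[OF I]]
  show "poly_ideal I"
    unfolding poly_ideal_def
    using sub[unfolded mpoly_ring_simps] I.I_l_closed[unfolded mpoly_ring_simps] by simp
next
  assume I: "poly_ideal I"
  interpret cring "mpoly_ring :: ('n, 'k) mpoly ring" by (rule cring_from_type_algebra)
  show "ideal I mpoly_ring"
  proof (rule idealI[OF ring_axioms])
    show "subgroup I (add_monoid mpoly_ring)"
    proof (rule add.subgroupI)
      show "I \<noteq> {}" using poly_idealD(1)[OF I] by blast
    qed (use poly_idealD[OF I] in \<open>auto simp: mpoly_ring_simps mpoly_ring_uminus simp flip: a_inv_def\<close>)
  qed (use poly_idealD[OF I] in \<open>auto simp: mpoly_ring_simps mult.commute\<close>)
qed

text \<open>
  A polynomial of \<open>van S\<close> is the sum of its homogeneous parts, which vanish on \<open>S\<close>. Conversely, a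
  constant vanishing at some point is zero, so the generators satisfy the condition on the
  constant term.
\<close>

lemma vanishing_ideal_eq:
  fixes S :: "('k::field ^ 'n::finite) set set"
  assumes S: "S \<noteq> {}" "S \<subseteq> proj_points"
  shows "vanishing_ideal S = van S"
proof -
  interpret cring "mpoly_ring :: ('n, 'k) mpoly ring" by (rule cring_from_type_algebra)
  let ?H = "{f :: ('n, 'k) mpoly. (\<exists>d. homogeneous d f) \<and> (\<forall>p\<in>S. vanishes_at f p)}"
  have Idl: "ideal (Idl\<^bsub>mpoly_ring\<^esub> ?H) mpoly_ring" "?H \<subseteq> Idl\<^bsub>mpoly_ring\<^esub> ?H"
    using genideal_ideal[of ?H] genideal_self[of ?H] by (simp_all add: mpoly_ring_simps)
  have hom: "f \<in> van S" if f: "homogeneous d f" "\<forall>p\<in>S. vanishes_at f p" for d f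
  proof (cases "d = 0")
    case False
    then show ?thesis
      using homogeneous_van[OF f(1)] f vanishes_at_iff S(2) by blast
  next
    case True
    obtain p where p: "p \<in> S" using S(1) by blast
    have z: "poly_eval f (rep p) = 0" using vanishes_at_iff[of p d f] f p S(2) by blast
    have m0: "m = 0" if "pm_lookup f m \<noteq> 0" for m
    proof -
      have "mdeg m = 0" using that f(1) True by (auto simp: homogeneous_iff)
      then show ?thesis by (auto simp: mdeg_def intro!: poly_mapping_eqI)
    qed
    have "f = pm_single 0 (pm_lookup f 0)"
      using m0 by (intro poly_mapping_eqI) (auto simp: lookup_single when_def)
    then have "f = 0" using z by (metis poly_eval_const single_zero)
    then show ?thesis using poly_idealD(1)[OF poly_ideal_van] by simp
  qed
  have "Idl\<^bsub>mpoly_ring\<^esub> ?H \<subseteq> van S"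
    using hom by (intro genideal_minimal) (auto simp: ideal_mpoly_ring_iff poly_ideal_van)
  moreover have "f \<in> Idl\<^bsub>mpoly_ring\<^esub> ?H" if f: "f \<in> van S" for f
  proof -
    have "hpart d f \<in> ?H" for d
    proof -
      have "vanishes_at (hpart d f) p" if "p \<in> S" for p
        using f that S(2) vanishes_at_iff[OF _ homogeneous_hpart, of p] by (auto simp: van_def)
      then show ?thesis using homogeneous_hpart by blast
    qed
    then have *: "hpart d f \<in> Idl\<^bsub>mpoly_ring\<^esub> ?H" for d using Idl(2) by blast
    obtain D where D: "f = (\<Sum>d\<le>D. hpart d f)" using sum_hpart by blast
    have "(\<Sum>d\<le>D. hpart d f) \<in> Idl\<^bsub>mpoly_ring\<^esub> ?H"
      using Idl(1) * by (intro poly_ideal_sum) (simp_all add: ideal_mpoly_ring_iff)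
    then show ?thesis by (simp flip: D)
  qed
  ultimately show ?thesis using S(1) by (auto simp: vanishing_ideal_def)
qed

locale point_set =
  fixes S :: "('k::field ^ 'n::finite) set set"
  assumes nonempty: "S \<noteq> {}" and points: "S \<subseteq> proj_points"
begin

definition cls :: "('n, 'k) mpoly \<Rightarrow> ('n, 'k) mpoly set" where
  "cls f = vanishing_ideal S +>\<^bsub>mpoly_ring\<^esub> f"

definition cls_pr :: "nat \<Rightarrow> ('n, 'k) mpoly set \<Rightarrow> ('n, 'k) mpoly set" where
  "cls_pr m c = cls (hpart m (SOME f. cls f = c))"

lemma van_ideal: "ideal (van S) mpoly_ring"
  by (simp add: ideal_mpoly_ring_iff poly_ideal_van)

lemma cls_set: "cls f = {g. g - f \<in> van S}"
proof -
  have "g \<in> cls f \<longleftrightarrow> g - f \<in> van S" for g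
  proof -
    have "g \<in> cls f \<longleftrightarrow> (\<exists>h\<in>van S. g = h + f)"
      by (simp add: cls_def a_r_coset_def' vanishing_ideal_eq nonempty points mpoly_ring_simps)
    then show ?thesis by (metis add_diff_cancel_right' diff_add_cancel)
  qed
  then show ?thesis by blast
qed

lemma cls_eq: "cls f = cls g \<longleftrightarrow> f - g \<in> van S"
proof
  assume "cls f = cls g"
  moreover have "f \<in> cls f" using poly_idealD(1)[OF poly_ideal_van] by (simp add: cls_set)
  ultimately have "f \<in> cls g" by simp
  then show "f - g \<in> van S" by (simp add: cls_set)
next
  assume d: "f - g \<in> van S"
  have "h - f \<in> van S \<longleftrightarrow> h - g \<in> van S" for h
    using poly_idealD(2)[OF poly_ideal_van _ d, of "h - f"] poly_idealD(5)[OF poly_ideal_van _ d, of "h - g"]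
    by auto
  then show "cls f = cls g" by (simp add: cls_set)
qed

lemma coord_ring_simps:
  "carrier (coord_ring S) = range cls"
  "\<zero>\<^bsub>coord_ring S\<^esub> = cls 0"
  "cls f \<oplus>\<^bsub>coord_ring S\<^esub> cls g = cls (f + g)"
  "cls f \<otimes>\<^bsub>coord_ring S\<^esub> cls g = cls (f * g)"
proof -
  interpret R: cring "mpoly_ring :: ('n, 'k) mpoly ring" by (rule cring_from_type_algebra)
  interpret I: ideal "van S" "mpoly_ring :: ('n, 'k) mpoly ring" by (rule van_ideal)
  have A: "coord_ring S = mpoly_ring Quot van S"
    by (simp add: coord_ring_def vanishing_ideal_eq nonempty points)
  have cls: "cls h = van S +>\<^bsub>mpoly_ring\<^esub> h" for h
    by (simp add: cls_def vanishing_ideal_eq nonempty points)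
  show "carrier (coord_ring S) = range cls"
    by (auto simp: A FactRing_def A_RCOSETS_def' cls mpoly_ring_simps)
  show "cls f \<oplus>\<^bsub>coord_ring S\<^esub> cls g = cls (f + g)"
    using ring_hom_add[OF I.rcos_ring_hom, of f g] by (simp add: A cls mpoly_ring_simps)
  show "cls f \<otimes>\<^bsub>coord_ring S\<^esub> cls g = cls (f * g)"
    using ring_hom_mult[OF I.rcos_ring_hom, of f g] by (simp add: A cls mpoly_ring_simps)
  show "\<zero>\<^bsub>coord_ring S\<^esub> = cls 0"
    by (auto simp: A FactRing_def cls_set)
qed

text \<open>
  The homogeneous part of a class does not depend on the representative because \<open>van S\<close> is closed
  under taking homogeneous parts.
\<close>

lemma cls_pr: "cls_pr m (cls f) = cls (hpart m f)"
proof -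
  have "cls (SOME g. cls g = cls f) = cls f" by (rule someI[of _ f]) simp
  then have "hpart m ((SOME g. cls g = cls f) - f) \<in> van S"
    by (intro hpart_van) (simp add: cls_eq)
  then show ?thesis by (simp add: cls_pr_def cls_eq hpart_minus)
qed

lemma coord_grading_eq: "coord_grading S m = cls ` {f. homogeneous m f}"
  by (auto simp: coord_grading_def cls_def)

lemma coord_cring: "cring (coord_ring S)"
proof -
  interpret R: cring "mpoly_ring :: ('n, 'k) mpoly ring" by (rule cring_from_type_algebra)
  interpret I: ideal "van S" "mpoly_ring :: ('n, 'k) mpoly ring" by (rule van_ideal)
  show ?thesis
    using I.quotient_is_cring[OF R.is_cring]
    by (simp add: coord_ring_def vanishing_ideal_eq nonempty points)
qed

sublocale A: graded_cring "coord_ring S" "coord_grading S" cls_pr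
proof (rule graded_cring.intro[OF coord_cring], unfold_locales)
  interpret cring "coord_ring S" by (rule coord_cring)
  show "cls_pr m a \<in> coord_grading S m" if "a \<in> carrier (coord_ring S)" for a m
    using that by (auto simp: coord_ring_simps cls_pr coord_grading_eq intro!: imageI homogeneous_hpart)
  show "a \<in> carrier (coord_ring S)" if "a \<in> coord_grading S m" for a m
    using that by (auto simp: coord_ring_simps coord_grading_eq)
  show "cls_pr m (a \<oplus>\<^bsub>coord_ring S\<^esub> b) = cls_pr m a \<oplus>\<^bsub>coord_ring S\<^esub> cls_pr m b"
    if "a \<in> carrier (coord_ring S)" "b \<in> carrier (coord_ring S)" for a b m
    using that by (auto simp: coord_ring_simps cls_pr hpart_add)
  show "cls_pr m a = a" if "a \<in> coord_grading S m" for a m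
    using that by (auto simp: coord_grading_eq cls_pr hpart_homogeneous)
  show "cls_pr m a = \<zero>\<^bsub>coord_ring S\<^esub>" if "a \<in> coord_grading S n" "m \<noteq> n" for a m n
    using that by (auto simp: coord_grading_eq cls_pr hpart_homogeneous coord_ring_simps)
  show "a \<otimes>\<^bsub>coord_ring S\<^esub> b \<in> coord_grading S (m + n)"
    if "a \<in> coord_grading S m" "b \<in> coord_grading S n" for a b m n
    using that by (auto simp: coord_grading_eq coord_ring_simps intro!: imageI homogeneous_mult)
  show "\<exists>d. a = (\<Oplus>\<^bsub>coord_ring S\<^esub>m\<in>{..d}. cls_pr m a)" if a: "a \<in> carrier (coord_ring S)" for a
  proof -
    obtain f where f: "a = cls f" using a by (auto simp: coord_ring_simps)
    obtain D where D: "f = (\<Sum>d\<le>D. hpart d f)" using sum_hpart by blast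
    have "(\<Oplus>\<^bsub>coord_ring S\<^esub>m\<in>{..d}. cls_pr m a) = cls (\<Sum>m\<le>d. hpart m f)" for d
    proof (induction d)
      case 0
      then show ?case by (simp add: f cls_pr coord_ring_simps)
    next
      case (Suc d)
      then show ?case
        by (simp add: f cls_pr coord_ring_simps Pi_def add.commute)
    qed
    from this[of D] show ?thesis by (metis D f)
  qed
qed

lemma cls_image_iff:
  assumes I: "poly_ideal I" "van S \<subseteq> I"
  shows "cls f \<in> cls ` I \<longleftrightarrow> f \<in> I"
proof
  assume "cls f \<in> cls ` I"
  then obtain g where g: "g \<in> I" "f - g \<in> van S" by (auto simp: cls_eq)
  then show "f \<in> I" using poly_idealD(2)[OF I(1), of "f - g" g] I(2) by auto
qed simp

lemma linear_quotients_cls_step: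
  assumes I: "poly_ideal I" "van S \<subseteq> I" "cls ` I \<in> A.linear_quotients \<Q>"
    and w: "homogeneous 1 w" "w \<notin> I" and Q: "cls ` {f. f * w \<in> I} \<in> \<Q>"
  shows "cls ` {a + f * w | a f. a \<in> I} \<in> A.linear_quotients \<Q>"
proof -
  have "A.colon_elem (cls ` I) (cls w) = cls ` {f. f * w \<in> I}"
  proof (intro equalityI subsetI)
    fix c assume "c \<in> A.colon_elem (cls ` I) (cls w)"
    then obtain f where "c = cls f" "cls (f * w) \<in> cls ` I"
      by (auto simp: A.colon_elem_def coord_ring_simps)
    then show "c \<in> cls ` {f. f * w \<in> I}" using cls_image_iff[OF I(1,2)] by blast
  qed (auto simp: A.colon_elem_def coord_ring_simps)
  then have "cls ` I <+>\<^bsub>coord_ring S\<^esub> PIdl\<^bsub>coord_ring S\<^esub> (cls w) \<in> A.linear_quotients \<Q>"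
    using w Q cls_image_iff[OF I(1,2)] by (intro A.linear_quotients.step I(3)) (auto simp: coord_grading_eq)
  moreover have "cls ` I <+>\<^bsub>coord_ring S\<^esub> PIdl\<^bsub>coord_ring S\<^esub> (cls w) = cls ` {a + f * w | a f. a \<in> I}"
  proof (intro equalityI subsetI)
    fix c assume "c \<in> cls ` I <+>\<^bsub>coord_ring S\<^esub> PIdl\<^bsub>coord_ring S\<^esub> (cls w)"
    then obtain a f where "a \<in> I" "c = cls a \<oplus>\<^bsub>coord_ring S\<^esub> cls f \<otimes>\<^bsub>coord_ring S\<^esub> cls w"
      unfolding A.add_PIdl_iff by (auto simp: coord_ring_simps(1))
    then show "c \<in> cls ` {a + f * w | a f. a \<in> I}" by (auto simp: coord_ring_simps)
  next
    fix c assume "c \<in> cls ` {a + f * w | a f. a \<in> I}"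
    then obtain a f where af: "a \<in> I" "c = cls (a + f * w)" by blast
    then have "c = cls a \<oplus>\<^bsub>coord_ring S\<^esub> cls f \<otimes>\<^bsub>coord_ring S\<^esub> cls w" by (simp add: coord_ring_simps)
    then show "c \<in> cls ` I <+>\<^bsub>coord_ring S\<^esub> PIdl\<^bsub>coord_ring S\<^esub> (cls w)"
      using af(1) A.add_PIdlI[of "cls a" "cls ` I" "cls f" "cls w"] by (simp add: coord_ring_simps(1))
  qed
  ultimately show ?thesis by simp
qed

lemma irrelevant_ideal_van: "irrelevant_ideal (coord_ring S) (coord_grading S) = cls ` van {}"
proof -
  have "cls (hpart 0 f) = cls 0 \<longleftrightarrow> hpart 0 f = 0" for f
  proof
    assume "cls (hpart 0 f) = cls 0"
    then have "hpart 0 f \<in> van S" by (simp add: cls_eq)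
    then show "hpart 0 f = 0" by (simp add: van_def hpart_hpart)
  qed simp
  then show ?thesis
    by (auto simp: A.irrelevant_ideal_eq coord_ring_simps cls_pr van_def)
qed

text \<open>
  The forms of \<open>W\<close> are adjoined one after the other. A form that is already contained in the ideal
  is skipped; every other one has the vanishing ideal of a subset of \<open>T'\<close> as its colon ideal.
\<close>

lemma linear_quotients_adjoin:
  fixes T T' :: "('k ^ 'n) set set"
  assumes TS: "T \<union> T' \<subseteq> S"
    and start: "cls ` van (T \<union> T') \<in> A.linear_quotients \<Q>"
    and Q: "\<And>P. P \<subseteq> T' \<Longrightarrow> cls ` van P \<in> \<Q>"
    and fin: "finite T'" "finite W"
    and dual: "\<And>q q'. \<lbrakk>q \<in> T'; q' \<in> T'\<rbrakk> \<Longrightarrow> poly_eval (lin (x q)) (rep q') = (if q' = q then 1 else 0)"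
    and W: "\<And>c p. \<lbrakk>c \<in> W; p \<in> T\<rbrakk> \<Longrightarrow> poly_eval (lin c) (rep p) = 0"
  shows "cls ` adjoin (van (T \<union> T')) W \<in> A.linear_quotients \<Q>"
  using fin(2) W
proof (induction W rule: finite_induct)
  case empty
  then show ?case using start by (simp add: adjoin_empty)
next
  case (insert w W)
  let ?J = "adjoin (van (T \<union> T')) W"
  have J: "poly_ideal ?J" by (rule poly_ideal_adjoin[OF poly_ideal_van])
  have IH: "cls ` ?J \<in> A.linear_quotients \<Q>" using insert by auto
  have SJ: "van S \<subseteq> ?J" using van_antimono[OF TS] adjoin_base by blast
  note ins = adjoin_insert[OF insert.hyps, of "van (T \<union> T')"]
  show ?case
  proof (cases "lin w \<in> ?J")
    case True
    have "adjoin (van (T \<union> T')) (insert w W) = ?J"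
    proof
      show "adjoin (van (T \<union> T')) (insert w W) \<subseteq> ?J"
        unfolding ins using True poly_idealD(2,3)[OF J] by auto
      show "?J \<subseteq> adjoin (van (T \<union> T')) (insert w W)"
      proof
        fix a assume "a \<in> ?J"
        moreover have "a = a + 0 * lin w" by simp
        ultimately show "a \<in> adjoin (van (T \<union> T')) (insert w W)" unfolding ins by blast
      qed
    qed
    then show ?thesis using IH by simp
  next
    case False
    have "{f. f * lin w \<in> ?J} =
        van {q \<in> T'. poly_eval (lin w) (rep q) \<noteq> 0 \<and> (\<forall>c\<in>W. poly_eval (lin c) (rep q) = 0)}"
      using insert.prems False insert.hyps(1) by (intro adjoin_colon[OF fin(1) _ dual]) auto
    then have "cls ` {f. f * lin w \<in> ?J} \<in> \<Q>" by (simp add: Q)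
    then show ?thesis
      unfolding ins by (intro linear_quotients_cls_step J SJ IH homogeneous_lin False)
  qed
qed

text \<open>
  The inductive step of the whole argument. It is applied to the members \<open>T\<close> and \<open>T'\<close> of \<open>\<Lambda>\<close>, and to
  a subset \<open>T\<close> of an independent set with a further point \<open>q\<close> of that set, where \<open>T' = {q}\<close>.
\<close>

lemma linear_quotients_extend:
  fixes T T' :: "('k ^ 'n) set set"
  assumes "T \<union> T' \<subseteq> S"
    and "cls ` van (T \<union> T') \<in> A.linear_quotients \<Q>"
    and "\<And>P. P \<subseteq> T' \<Longrightarrow> cls ` van P \<in> \<Q>"
    and fin: "finite T'"
    and dual: "\<And>q q'. \<lbrakk>q \<in> T'; q' \<in> T'\<rbrakk> \<Longrightarrow> poly_eval (lin (x q)) (rep q') = (if q' = q then 1 else 0)"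
    and sep: "\<And>q. q \<in> T' \<Longrightarrow>
      \<exists>c. (\<forall>p\<in>T. poly_eval (lin c) (rep p) = 0) \<and> poly_eval (lin c) (rep q) \<noteq> 0"
  shows "cls ` van T \<in> A.linear_quotients \<Q>"
proof -
  obtain W where W: "finite W" "\<forall>c\<in>W. \<forall>p\<in>T. poly_eval (lin c) (rep p) = 0"
    "van T = adjoin (van (T \<union> T')) W"
    using van_eq_adjoin[of T' x T, OF fin dual sep] by blast
  show ?thesis
    unfolding W(3) using W(2) by (intro linear_quotients_adjoin[OF assms(1-3) fin W(1) dual]) auto
qed

end

lemma linear_section_separates:
  assumes T: "T \<in> linear_sections S" and S: "S \<subseteq> proj_points" and q: "q \<in> S" "q \<notin> T"
  shows "\<exists>c. (\<forall>p\<in>T. poly_eval (lin c) (rep p) = 0) \<and> poly_eval (lin c) (rep q) \<noteq> 0"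
proof -
  obtain W where W: "vec.subspace W" "T = {p \<in> S. p \<subseteq> W}"
    using T by (auto simp: linear_sections_def)
  have "rep q \<notin> W"
  proof
    assume "rep q \<in> W"
    then have "vec.span {rep q} \<subseteq> W" using W(1) by (intro vec.span_minimal) auto
    then show False using span_rep[of q] S q W(2) by auto
  qed
  then obtain c where c: "\<forall>u\<in>W. poly_eval (lin c) u = 0" "poly_eval (lin c) (rep q) \<noteq> 0"
    using linear_form_separates[OF W(1)] by blast
  have "rep p \<in> W" if "p \<in> T" for p
    using that W(2) S span_rep[of p] vec.span_base[of "rep p" "{rep p}"] by auto
  then show ?thesis using c by blast
qed

theorem theorem0p1:
  fixes S :: "('k::field ^ 'n::finite) set set"
    and \<Lambda> :: "('k ^ 'n) set set set"
  assumes "finite S"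
    and "S \<subseteq> proj_points"
    and "\<Lambda> \<subseteq> linear_sections S"
    and "card \<Lambda> > 1"
    and "\<forall>T\<in>\<Lambda>. T \<noteq> S \<longrightarrow>
           (\<exists>T'\<in>\<Lambda>. T' \<noteq> {} \<and> linearly_independent_points T' \<and> T \<inter> T' = {} \<and> T \<union> T' \<in> \<Lambda>)"
  shows "koszul_points S \<and>
         (\<exists>\<F>. koszul_filtration (coord_ring S) (coord_grading S) \<F>)"
proof -
  have sub: "T \<subseteq> S" if "T \<in> \<Lambda>" for T
    using that assms(3) by (auto simp: linear_sections_def)
  \<comment> \<open>A member of \<open>\<Lambda>\<close> other than \<open>S\<close> provides an independent \<open>T1\<close>, and then \<open>A_+\<close> comes from \<open>{} \<subseteq> T1\<close>.\<close>
  have "\<exists>T0\<in>\<Lambda>. T0 \<noteq> S"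
  proof (rule ccontr)
    assume "\<not> ?thesis"
    then have "\<Lambda> \<subseteq> {S}" by blast
    then have "card \<Lambda> \<le> card {S}" by (intro card_mono) auto
    then show False using assms(4) by simp
  qed
  then obtain T1 where T1: "T1 \<in> \<Lambda>" "T1 \<noteq> {}" "linearly_independent_points T1"
    using assms(5) by blast
  interpret point_set S
    using T1 sub assms(2) by unfold_locales blast+
  define \<Q> where "\<Q> = {cls ` van P | P T. P \<subseteq> T \<and> T \<in> \<Lambda> \<and> linearly_independent_points T}"
  have Q_mem: "cls ` van P \<in> \<Q>" if "P \<subseteq> T" "T \<in> \<Lambda>" "linearly_independent_points T" for P T
    using that unfolding \<Q>_def by blast
  have dual: "\<exists>x. \<forall>q\<in>T. \<forall>q'\<in>T. poly_eval (lin (x q)) (rep q') = (if q' = q then 1 else 0)"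
    if "T \<in> \<Lambda>" "linearly_independent_points T" for T
    using that sub assms(2) by (intro dual_linear_forms) auto
  \<comment> \<open>Vanishing ideals of members of \<open>\<Lambda>\<close>, by descending induction starting from \<open>T = S\<close>, which gives the zero ideal.\<close>
  have Lam: "cls ` van T \<in> A.linear_quotients \<Q>" if "T \<in> \<Lambda>" for T
    using that
  proof (induction "card (S - T)" arbitrary: T rule: less_induct)
    case less
    show ?case
    proof (cases "T = S")
      case True
      have "cls f = cls 0" if "f \<in> van S" for f using that by (simp add: cls_eq)
      moreover have "0 \<in> van S" using poly_idealD(1)[OF poly_ideal_van] .
      ultimately have "cls ` van T = {\<zero>\<^bsub>coord_ring S\<^esub>}"
        unfolding coord_ring_simps True by blast
      then show ?thesis using A.linear_quotients.zero by simp
    next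
      case False
      then obtain T' where T': "T' \<in> \<Lambda>" "T' \<noteq> {}" "linearly_independent_points T'"
          "T \<inter> T' = {}" "T \<union> T' \<in> \<Lambda>"
        using assms(5) less.prems by blast
      obtain x where x: "\<And>q q'. \<lbrakk>q \<in> T'; q' \<in> T'\<rbrakk> \<Longrightarrow>
          poly_eval (lin (x q)) (rep q') = (if q' = q then 1 else 0)"
        using dual[OF T'(1,3)] by blast
      have "S - (T \<union> T') \<subset> S - T" using T'(2,4) sub[OF T'(1)] by blast
      then have "card (S - (T \<union> T')) < card (S - T)"
        using assms(1) by (intro psubset_card_mono) auto
      then have IH: "cls ` van (T \<union> T') \<in> A.linear_quotients \<Q>" using less.hyps T'(5) by blast
      show ?thesis
      proof (rule linear_quotients_extend[OF sub[OF T'(5)] IH])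
        show "cls ` van P \<in> \<Q>" if "P \<subseteq> T'" for P using Q_mem[OF that T'(1,3)] .
        show "finite T'" using sub[OF T'(1)] assms(1) finite_subset by blast
        show "poly_eval (lin (x q)) (rep q') = (if q' = q then 1 else 0)"
          if "q \<in> T'" "q' \<in> T'" for q q' using x that .
        show "\<exists>c. (\<forall>p\<in>T. poly_eval (lin c) (rep p) = 0) \<and> poly_eval (lin c) (rep q) \<noteq> 0"
          if "q \<in> T'" for q
          using that T'(1,4) sub[OF T'(1)] less.prems assms(2,3)
          by (intro linear_section_separates[of T S]) auto
      qed
    qed
  qed
  \<comment> \<open>The colon ideals, by removing points one at a time from an independent member of \<open>\<Lambda>\<close>.\<close>
  have sublq: "cls ` van P \<in> A.linear_quotients \<Q>"
    if T: "T \<in> \<Lambda>" "linearly_independent_points T" and "P \<subseteq> T" for P T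
    using that(3)
  proof (induction "card (T - P)" arbitrary: P rule: less_induct)
    case less
    obtain x where x: "\<And>q q'. \<lbrakk>q \<in> T; q' \<in> T\<rbrakk> \<Longrightarrow>
        poly_eval (lin (x q)) (rep q') = (if q' = q then 1 else 0)"
      using dual[OF T] by blast
    have finT: "finite T" using sub[OF T(1)] assms(1) finite_subset by blast
    show ?case
    proof (cases "P = T")
      case True
      then show ?thesis using Lam T(1) by simp
    next
      case False
      then obtain q where q: "q \<in> T" "q \<notin> P" using less.prems by blast
      have "T - (P \<union> {q}) \<subset> T - P" using q by blast
      then have "card (T - (P \<union> {q})) < card (T - P)"
        using finT by (intro psubset_card_mono) auto
      then have IH: "cls ` van (P \<union> {q}) \<in> A.linear_quotients \<Q>"
        using less.hyps less.prems q(1) by blast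
      show ?thesis
      proof (rule linear_quotients_extend[OF _ IH])
        show "P \<union> {q} \<subseteq> S" using q(1) less.prems sub[OF T(1)] by blast
        show "cls ` van P' \<in> \<Q>" if "P' \<subseteq> {q}" for P'
          using that q(1) T by (intro Q_mem[of P' T]) auto
        show "poly_eval (lin (x r)) (rep r') = (if r' = r then 1 else 0)"
          if "r \<in> {q}" "r' \<in> {q}" for r r' using x that q(1) by auto
        show "\<exists>c. (\<forall>p\<in>P. poly_eval (lin c) (rep p) = 0) \<and> poly_eval (lin c) (rep r) \<noteq> 0"
          if "r \<in> {q}" for r
          using that q less.prems x[OF q(1)] by (intro exI[of _ "x q"]) auto
      qed simp
    qed
  qed
  have Q: "\<Q> \<subseteq> A.linear_quotients \<Q>"
    unfolding \<Q>_def using sublq unfolding \<Q>_def by blast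
  have irr: "irrelevant_ideal (coord_ring S) (coord_grading S) \<in> A.linear_quotients \<Q>"
    unfolding irrelevant_ideal_van using sublq[OF T1(1,3)] by simp
  show ?thesis
    unfolding koszul_points_def
    using A.koszul_algebra_linear_quotients[OF Q irr] A.koszul_filtration_linear_quotients[OF Q irr]
    by blast
qed

end
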